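(* Let $(\Sigma,\psi)$ be a strictly decreasing $2$-polygraph, and let $\mathcal{S}^{sd}(\Sigma,\psi)$ be a strictly decreasing Squier's completion of $\Sigma$ with respect to $\psi$. If $\psi$ is compatible with contexts and $(\Sigma,\psi)$ is Peiffer decreasing with respect to the extension $\mathcal{S}^{sd}(\Sigma,\psi)$, then $\mathcal{S}^{sd}(\Sigma,\psi)$ is a coherent presentation of the category presented by $\Sigma$.
   Context: **Polygraphs.** A $2$-polygraph $\Sigma=(\Sigma_0,\Sigma_1,\Sigma_2)$ consists of a directed graph with set of vertices ($0$-cells) $\Sigma_0$ and set of edges ($1$-cells) $\Sigma_1$, and a set $\Sigma_2$ (of $2$-cells) with maps $s_1,t_1:\Sigma_2\to\Sigma_1^*$, where $\Sigma_1^*$ is the free category on the graph, such that $s_1(\alpha)$ and $t_1(\alpha)$ are parallel for every $\alpha\in\Sigma_2$. The category presented by $\Sigma$ is the quotient of $\Sigma_1^*$ by the congruence generated by $\Sigma_2$. $\Sigma_2^*$ denotes the free $2$-category generated by $\Sigma$ and $\Sigma_2^\top$ the free $(2,1)$-category generated by $\Sigma$ (all $2$-cells invertible for $\star_1$; the inverse of $f$ is $f^-$). $\star_0$ (also written by juxtaposition) composes along $0$-cells and $\star_1$ along $1$-cells; $s_1,t_1$ are the $1$-source and $1$-target of a $2$-cell. A $2$-sphere is a pair $(f,g)$ of $2$-cells with $s_1(f)=s_1(g)$ and $t_1(f)=t_1(g)$. **Rewriting.** A rewriting step is a $2$-cell $u\varphi v$ of $\Sigma_2^*$ with $u,v$ $1$-cells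 of $\Sigma_1^*$ and $\varphi\in\Sigma_2$. A (finite, possibly empty) rewriting sequence $f_1\cdot\ldots\cdot f_k$ is a sequence of composable rewriting steps; it determines the $2$-cell $f_1\star_1\cdots\star_1 f_k$ of $\Sigma_2^*$. A branching is a pair $(f,g)$ of rewriting sequences with the same source; it is local if $f,g$ are rewriting steps. A confluence diagram of $(f,g)$ is a pair $(f\cdot f',g\cdot g')$ of rewriting sequences with the same target. A local branching is aspherical if $f=g$; it is a Peiffer branching if it has the form $(fv,ug)$ with rewriting steps $f:u\Rightarrow u'$, $g:v\Rightarrow v'$ and $u,v$ composable; it is overlapping if neither aspherical nor Peiffer. A critical branching is an overlapping branching minimal for the order generated by $(f,g)\sqsubseteq(wfw',wgw')$, for composable $1$-cells $w,w'$. Branchings $(f,g)$ and $(g,f)$ are not distinguished. **Strict decreasingness.** A well-founded labelling of $\Sigma$ is a map $\psi$ from rewriting steps of $\Sigma$ to a set $W$ with a well-founded order $\prec$; $L^W(f)$ denotes the set of labels of the steps of a rewriting sequence $f$. A confluence diagram $(f\cdot f',g\cdot g')$ of a local branching $(f,g)$ is strictly decreasing if $k\prec\psi(f)$ for all $k\in L^W(f')$ and $k\prec\psi(g)$ for all $k\in L^W(g')$. $(\Sigma,\psi)$ is strictly decreasing if every local branching has a strictly decreasing confluence diagram with respect to $\psi$. The labelling $\psi$ is compatible with contexts if for every strictly decreasing confluence diagram $(f\cdot f',g\cdot g')$ of a local branching $(f,g)$ and all composable $1$-cells $u_1,u_2$ of $\Sigma_1^*$, the confluence diagram $(u_1fu_2\cdot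 u_1f'u_2,\;u_1gu_2\cdot u_1g'u_2)$ is strictly decreasing. **Globular extensions.** A globular extension of $\Sigma_2^\top$ is a set $\Gamma$ (of $3$-cells) with maps $s_2,t_2$ from $\Gamma$ to $2$-cells of $\Sigma_2^\top$ such that $s_2(A),t_2(A)$ are parallel for all $A\in\Gamma$. A pair $(\Sigma,\Gamma)$ is a $(3,1)$-polygraph; it generates a free $(3,1)$-category (a $3$-category with all $2$-cells and $3$-cells invertible). Write $f\equiv_\Gamma g$ if $f,g$ become equal in the quotient of $\Sigma_2^\top$ by the congruence on $2$-cells generated by $\Gamma$. $(\Sigma,\Gamma)$ is a coherent presentation of the category presented by $\Sigma$ if for every $2$-sphere $(f,g)$ of $\Sigma_2^\top$ there is a $3$-cell from $f$ to $g$ in the free $(3,1)$-category generated by $(\Sigma,\Gamma)$. **Peiffer decreasingness.** A strictly decreasing $(\Sigma,\psi)$ is Peiffer decreasing with respect to a globular extension $\Gamma$ if for every Peiffer branching $(fv,ug):uv\Rightarrow(u'v,uv')$ there is a strictly decreasing confluence diagram $(fv\cdot f',ug\cdot g')$ such that $u'g\star_1(fv')^-\equiv_\Gamma f'\star_1(g')^-$. **Loops.** A $2$-loop is a $2$-cell $f$ of $\Sigma_2^*$ with $s_1(f)=t_1(f)$. Two $2$-loops $f,g$ are equivalent if there are a decomposition $f=f_1\star_1\cdots\star_1f_p$ into rewriting steps and a circular permutation $\sigma$ with $g=f_{\sigma(1)}\star_1\cdots\star_1f_{\sigma(p)}$. A $2$-loop $f$ is minimal with respect to $1$-composition if in any decomposition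 $f=g\star_1h\star_1k$ in $\Sigma_2^*$ with $h$ a $2$-loop, $h$ is an identity or equals $f$; it is minimal by context if there is no decomposition $f=ugv$ with $u,v$ nonidentity $1$-cells and $g$ a $2$-loop; it is elementary if it is minimal in both senses. A loop extension $\mathcal{L}(\Sigma)$ is a globular extension of $\Sigma_2^\top$ made of $3$-cells $A_\alpha:\alpha\Rrightarrow 1_{s_1(\alpha)}$ for exactly one representative $\alpha$ of each equivalence class of elementary $2$-loops. **Squier's completion.** A family of generating strictly decreasing confluences $\mathcal{O}(\Sigma,\psi)$ is a globular extension of $\Sigma_2^\top$ containing, for every critical branching $(f,g)$, exactly one $3$-cell $D^\psi_{f,g}:f\star_1f'\Rrightarrow g\star_1g'$ where $(f\cdot f',g\cdot g')$ is a strictly decreasing confluence diagram with respect to $\psi$. A strictly decreasing Squier's completion $\mathcal{S}^{sd}(\Sigma,\psi)$ is the $(3,1)$-polygraph extending $\Sigma$ by $\mathcal{O}(\Sigma,\psi)\cup\mathcal{L}(\Sigma)$ for some such choices. "With respect to the extension $\mathcal{S}^{sd}(\Sigma,\psi)$" means with respect to this globular extension. *)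

theory Defs
  imports "Graph_Theory.Arc_Walk"
begin

section \<open>Free categories and 2-polygraphs\<close>

text \<open>A 1-cell is a walk stored together with its two endpoints, so that identities of
  different 0-cells are different and both endpoints are projections.\<close>

type_synonym ('v, 'e) cell1 = "'v \<times> 'e list \<times> 'v"

definition src0 :: "('v, 'e) cell1 \<Rightarrow> 'v" where
  "src0 p = fst p"

definition tgt0 :: "('v, 'e) cell1 \<Rightarrow> 'v" where
  "tgt0 p = snd (snd p)"

definition ident0 :: "'v \<Rightarrow> ('v, 'e) cell1" where
  "ident0 x = (x, [], x)"

definition comp1 :: "('v, 'e) cell1 \<Rightarrow> ('v, 'e) cell1 \<Rightarrow> ('v, 'e) cell1" where
  "comp1 p q = (src0 p, fst (snd p) @ fst (snd q), tgt0 q)"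

record ('v, 'e, 'a) polygraph2 =
  graph :: "('v, 'e) pre_digraph"
  gens2 :: "'a set"
  gsrc1 :: "'a \<Rightarrow> ('v, 'e) cell1"
  gtgt1 :: "'a \<Rightarrow> ('v, 'e) cell1"

definition cells1 :: "('v, 'e, 'a) polygraph2 \<Rightarrow> ('v, 'e) cell1 set" where
  "cells1 P = {(x, es, y). pre_digraph.awalk (graph P) x es y}"

definition two_polygraph :: "('v, 'e, 'a) polygraph2 \<Rightarrow> bool" where
  "two_polygraph P \<longleftrightarrow> wf_digraph (graph P) \<and>
     (\<forall>\<alpha> \<in> gens2 P. gsrc1 P \<alpha> \<in> cells1 P \<and> gtgt1 P \<alpha> \<in> cells1 P \<and>
        src0 (gsrc1 P \<alpha>) = src0 (gtgt1 P \<alpha>) \<and> tgt0 (gsrc1 P \<alpha>) = tgt0 (gtgt1 P \<alpha>))"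


section \<open>The free 2-category and the free (2,1)-category on a 2-polygraph\<close>

text \<open>Both are built as formal composites modulo the axioms of strict 2-categories.
  The flag \<open>b\<close> below tells whether formal inverses are allowed: \<open>b = False\<close> gives the
  free 2-category and \<open>b = True\<close> the free (2,1)-category.  \<open>HC\<close> is composition along
  0-cells, \<open>VC\<close> composition along 1-cells in diagrammatic order.\<close>

datatype ('v, 'e, 'a) expr2 =
    Gen 'a
  | Idn "('v, 'e) cell1"
  | HC "('v, 'e, 'a) expr2" "('v, 'e, 'a) expr2"
  | VC "('v, 'e, 'a) expr2" "('v, 'e, 'a) expr2"
  | Inv "('v, 'e, 'a) expr2"

fun esrc1 :: "('v, 'e, 'a) polygraph2 \<Rightarrow> ('v, 'e, 'a) expr2 \<Rightarrow> ('v, 'e) cell1"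
  and etgt1 :: "('v, 'e, 'a) polygraph2 \<Rightarrow> ('v, 'e, 'a) expr2 \<Rightarrow> ('v, 'e) cell1" where
  "esrc1 P (Gen \<alpha>) = gsrc1 P \<alpha>"
| "esrc1 P (Idn p) = p"
| "esrc1 P (HC f g) = comp1 (esrc1 P f) (esrc1 P g)"
| "esrc1 P (VC f g) = esrc1 P f"
| "esrc1 P (Inv f) = etgt1 P f"
| "etgt1 P (Gen \<alpha>) = gtgt1 P \<alpha>"
| "etgt1 P (Idn p) = p"
| "etgt1 P (HC f g) = comp1 (etgt1 P f) (etgt1 P g)"
| "etgt1 P (VC f g) = etgt1 P g"
| "etgt1 P (Inv f) = esrc1 P f"

primrec wf2 :: "('v, 'e, 'a) polygraph2 \<Rightarrow> bool \<Rightarrow> ('v, 'e, 'a) expr2 \<Rightarrow> bool" where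
  "wf2 P b (Gen \<alpha>) \<longleftrightarrow> \<alpha> \<in> gens2 P"
| "wf2 P b (Idn p) \<longleftrightarrow> p \<in> cells1 P"
| "wf2 P b (HC f g) \<longleftrightarrow> wf2 P b f \<and> wf2 P b g \<and> tgt0 (esrc1 P f) = src0 (esrc1 P g)"
| "wf2 P b (VC f g) \<longleftrightarrow> wf2 P b f \<and> wf2 P b g \<and> etgt1 P f = esrc1 P g"
| "wf2 P b (Inv f) \<longleftrightarrow> b \<and> wf2 P b f"

inductive eq2 :: "('v, 'e, 'a) polygraph2 \<Rightarrow> bool \<Rightarrow>
    ('v, 'e, 'a) expr2 \<Rightarrow> ('v, 'e, 'a) expr2 \<Rightarrow> bool" for P b where
  refl: "wf2 P b f \<Longrightarrow> eq2 P b f f"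
| sym: "eq2 P b f g \<Longrightarrow> eq2 P b g f"
| trans: "eq2 P b f g \<Longrightarrow> eq2 P b g h \<Longrightarrow> eq2 P b f h"
| cong_HC: "eq2 P b f f' \<Longrightarrow> eq2 P b g g' \<Longrightarrow> wf2 P b (HC f g) \<Longrightarrow> eq2 P b (HC f g) (HC f' g')"
| cong_VC: "eq2 P b f f' \<Longrightarrow> eq2 P b g g' \<Longrightarrow> wf2 P b (VC f g) \<Longrightarrow> eq2 P b (VC f g) (VC f' g')"
| cong_Inv: "eq2 P b f f' \<Longrightarrow> wf2 P b (Inv f) \<Longrightarrow> eq2 P b (Inv f) (Inv f')"
| assoc_HC: "wf2 P b (HC (HC f g) h) \<Longrightarrow> eq2 P b (HC (HC f g) h) (HC f (HC g h))"
| assoc_VC: "wf2 P b (VC (VC f g) h) \<Longrightarrow> eq2 P b (VC (VC f g) h) (VC f (VC g h))"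
| unitl_HC: "wf2 P b f \<Longrightarrow> eq2 P b (HC (Idn (ident0 (src0 (esrc1 P f)))) f) f"
| unitr_HC: "wf2 P b f \<Longrightarrow> eq2 P b (HC f (Idn (ident0 (tgt0 (esrc1 P f))))) f"
| unitl_VC: "wf2 P b f \<Longrightarrow> eq2 P b (VC (Idn (esrc1 P f)) f) f"
| unitr_VC: "wf2 P b f \<Longrightarrow> eq2 P b (VC f (Idn (etgt1 P f))) f"
| id_HC: "wf2 P b (HC (Idn p) (Idn q)) \<Longrightarrow> eq2 P b (HC (Idn p) (Idn q)) (Idn (comp1 p q))"
| exchange: "wf2 P b (HC (VC f g) (VC h k)) \<Longrightarrow>
    eq2 P b (HC (VC f g) (VC h k)) (VC (HC f h) (HC g k))"
| invr: "wf2 P b (Inv f) \<Longrightarrow> eq2 P b (VC f (Inv f)) (Idn (esrc1 P f))"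
| invl: "wf2 P b (Inv f) \<Longrightarrow> eq2 P b (VC (Inv f) f) (Idn (etgt1 P f))"

type_synonym ('v, 'e, 'a) cell2 = "('v, 'e, 'a) expr2 set"

definition cls2 :: "('v, 'e, 'a) polygraph2 \<Rightarrow> bool \<Rightarrow> ('v, 'e, 'a) expr2 \<Rightarrow> ('v, 'e, 'a) cell2" where
  "cls2 P b f = {g. eq2 P b f g}"

definition cells2 :: "('v, 'e, 'a) polygraph2 \<Rightarrow> bool \<Rightarrow> ('v, 'e, 'a) cell2 set" where
  "cells2 P b = cls2 P b ` {f. wf2 P b f}"

text \<open>All representatives of a 2-cell share their 1-source and 1-target, so \<open>the_elem\<close> is well-defined here.\<close>

definition src1 :: "('v, 'e, 'a) polygraph2 \<Rightarrow> ('v, 'e, 'a) cell2 \<Rightarrow> ('v, 'e) cell1" where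
  "src1 P F = the_elem (esrc1 P ` F)"

definition tgt1 :: "('v, 'e, 'a) polygraph2 \<Rightarrow> ('v, 'e, 'a) cell2 \<Rightarrow> ('v, 'e) cell1" where
  "tgt1 P F = the_elem (etgt1 P ` F)"

definition gen2 :: "('v, 'e, 'a) polygraph2 \<Rightarrow> bool \<Rightarrow> 'a \<Rightarrow> ('v, 'e, 'a) cell2" where
  "gen2 P b \<alpha> = cls2 P b (Gen \<alpha>)"

definition ident1 :: "('v, 'e, 'a) polygraph2 \<Rightarrow> bool \<Rightarrow> ('v, 'e) cell1 \<Rightarrow> ('v, 'e, 'a) cell2" where
  "ident1 P b p = cls2 P b (Idn p)"

definition hcomp :: "('v, 'e, 'a) polygraph2 \<Rightarrow> bool \<Rightarrow>
    ('v, 'e, 'a) cell2 \<Rightarrow> ('v, 'e, 'a) cell2 \<Rightarrow> ('v, 'e, 'a) cell2" where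
  "hcomp P b F G = (\<Union>f \<in> F. \<Union>g \<in> G. cls2 P b (HC f g))"

definition vcomp :: "('v, 'e, 'a) polygraph2 \<Rightarrow> bool \<Rightarrow>
    ('v, 'e, 'a) cell2 \<Rightarrow> ('v, 'e, 'a) cell2 \<Rightarrow> ('v, 'e, 'a) cell2" where
  "vcomp P b F G = (\<Union>f \<in> F. \<Union>g \<in> G. cls2 P b (VC f g))"

definition inv2 :: "('v, 'e, 'a) polygraph2 \<Rightarrow> ('v, 'e, 'a) cell2 \<Rightarrow> ('v, 'e, 'a) cell2" where
  "inv2 P F = (\<Union>f \<in> F. cls2 P True (Inv f))"

definition whisker :: "('v, 'e, 'a) polygraph2 \<Rightarrow> bool \<Rightarrow>
    ('v, 'e) cell1 \<Rightarrow> ('v, 'e, 'a) cell2 \<Rightarrow> ('v, 'e) cell1 \<Rightarrow> ('v, 'e, 'a) cell2" where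
  "whisker P b u F v = hcomp P b (hcomp P b (ident1 P b u) F) (ident1 P b v)"

definition composable_ctx :: "('v, 'e, 'a) polygraph2 \<Rightarrow>
    ('v, 'e) cell1 \<Rightarrow> ('v, 'e, 'a) cell2 \<Rightarrow> ('v, 'e) cell1 \<Rightarrow> bool" where
  "composable_ctx P u F v \<longleftrightarrow> u \<in> cells1 P \<and> v \<in> cells1 P \<and>
     tgt0 u = src0 (src1 P F) \<and> tgt0 (src1 P F) = src0 v"

text \<open>The canonical 2-functor from the free 2-category to the free (2,1)-category.\<close>

definition incl2 :: "('v, 'e, 'a) polygraph2 \<Rightarrow> ('v, 'e, 'a) cell2 \<Rightarrow> ('v, 'e, 'a) cell2" where
  "incl2 P F = (\<Union>f \<in> F. cls2 P True f)"


section \<open>Rewriting steps, sequences and local branchings\<close>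

text \<open>Rewriting steps are 2-cells of the free 2-category, not triples (context, generator, context).\<close>

definition steps :: "('v, 'e, 'a) polygraph2 \<Rightarrow> ('v, 'e, 'a) cell2 set" where
  "steps P = {whisker P False u (gen2 P False \<alpha>) v | u \<alpha> v.
     \<alpha> \<in> gens2 P \<and> composable_ctx P u (gen2 P False \<alpha>) v}"

primrec rseq :: "('v, 'e, 'a) polygraph2 \<Rightarrow>
    ('v, 'e) cell1 \<Rightarrow> ('v, 'e, 'a) cell2 list \<Rightarrow> ('v, 'e) cell1 \<Rightarrow> bool" where
  "rseq P p [] q \<longleftrightarrow> p \<in> cells1 P \<and> p = q"
| "rseq P p (F # Fs) q \<longleftrightarrow> F \<in> steps P \<and> src1 P F = p \<and> rseq P (tgt1 P F) Fs q"

primrec seq_cell :: "('v, 'e, 'a) polygraph2 \<Rightarrow>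
    ('v, 'e) cell1 \<Rightarrow> ('v, 'e, 'a) cell2 list \<Rightarrow> ('v, 'e, 'a) cell2" where
  "seq_cell P p [] = ident1 P False p"
| "seq_cell P p (F # Fs) = vcomp P False F (seq_cell P (tgt1 P F) Fs)"

definition local_branching :: "('v, 'e, 'a) polygraph2 \<Rightarrow>
    ('v, 'e, 'a) cell2 \<Rightarrow> ('v, 'e, 'a) cell2 \<Rightarrow> bool" where
  "local_branching P F G \<longleftrightarrow> F \<in> steps P \<and> G \<in> steps P \<and> src1 P F = src1 P G"

definition confluence_diagram :: "('v, 'e, 'a) polygraph2 \<Rightarrow>
    ('v, 'e, 'a) cell2 \<Rightarrow> ('v, 'e, 'a) cell2 list \<Rightarrow>
    ('v, 'e, 'a) cell2 \<Rightarrow> ('v, 'e, 'a) cell2 list \<Rightarrow> bool" where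
  "confluence_diagram P F Fs G Gs \<longleftrightarrow> local_branching P F G \<and>
     (\<exists>q. rseq P (tgt1 P F) Fs q \<and> rseq P (tgt1 P G) Gs q)"

text \<open>In \<open>peiffer_pair P F G\<close> the steps \<open>F\<close>, \<open>G\<close> are those acting on the left and on the right
  factor; the branching itself is given by \<open>peiffer_left\<close> and \<open>peiffer_right\<close>.\<close>

definition peiffer_pair :: "('v, 'e, 'a) polygraph2 \<Rightarrow>
    ('v, 'e, 'a) cell2 \<Rightarrow> ('v, 'e, 'a) cell2 \<Rightarrow> bool" where
  "peiffer_pair P F G \<longleftrightarrow> F \<in> steps P \<and> G \<in> steps P \<and> tgt0 (src1 P F) = src0 (src1 P G)"

definition peiffer_left :: "('v, 'e, 'a) polygraph2 \<Rightarrow>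
    ('v, 'e, 'a) cell2 \<Rightarrow> ('v, 'e, 'a) cell2 \<Rightarrow> ('v, 'e, 'a) cell2" where
  "peiffer_left P F G = hcomp P False F (ident1 P False (src1 P G))"

definition peiffer_right :: "('v, 'e, 'a) polygraph2 \<Rightarrow>
    ('v, 'e, 'a) cell2 \<Rightarrow> ('v, 'e, 'a) cell2 \<Rightarrow> ('v, 'e, 'a) cell2" where
  "peiffer_right P F G = hcomp P False (ident1 P False (src1 P F)) G"

text \<open>Branchings are considered up to exchanging their two components, so local branchings are
  encoded as sets \<open>{F, G}\<close> of steps from here on, whenever the order plays no role.\<close>

definition local_branchings :: "('v, 'e, 'a) polygraph2 \<Rightarrow> ('v, 'e, 'a) cell2 set set" where
  "local_branchings P = {{F, G} | F G. local_branching P F G}"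

definition aspherical_branchings :: "('v, 'e, 'a) polygraph2 \<Rightarrow> ('v, 'e, 'a) cell2 set set" where
  "aspherical_branchings P = {{F, F} | F. F \<in> steps P}"

definition peiffer_branchings :: "('v, 'e, 'a) polygraph2 \<Rightarrow> ('v, 'e, 'a) cell2 set set" where
  "peiffer_branchings P = {{peiffer_left P F G, peiffer_right P F G} | F G. peiffer_pair P F G}"

definition overlapping_branchings :: "('v, 'e, 'a) polygraph2 \<Rightarrow> ('v, 'e, 'a) cell2 set set" where
  "overlapping_branchings P = local_branchings P - aspherical_branchings P - peiffer_branchings P"

definition ctx_branching :: "('v, 'e, 'a) polygraph2 \<Rightarrow>
    ('v, 'e, 'a) cell2 set \<Rightarrow> ('v, 'e, 'a) cell2 set \<Rightarrow> bool" where
  "ctx_branching P B B' \<longleftrightarrow> B \<in> local_branchings P \<and>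
     (\<exists>w w'. (\<forall>F \<in> B. composable_ctx P w F w') \<and> B' = (\<lambda>F. whisker P False w F w') ` B)"

definition critical_branchings :: "('v, 'e, 'a) polygraph2 \<Rightarrow> ('v, 'e, 'a) cell2 set set" where
  "critical_branchings P = {B \<in> overlapping_branchings P.
     \<forall>B' \<in> local_branchings P. (ctx_branching P)\<^sup>*\<^sup>* B' B \<longrightarrow> B' = B}"


section \<open>Labellings and strict decreasingness\<close>

text \<open>\<open>(k, l) \<in> r\<close> means that \<open>k\<close> is strictly below \<open>l\<close>.\<close>

definition sd_diagram :: "('v, 'e, 'a) polygraph2 \<Rightarrow> ('w \<times> 'w) set \<Rightarrow>
    (('v, 'e, 'a) cell2 \<Rightarrow> 'w) \<Rightarrow>
    ('v, 'e, 'a) cell2 \<Rightarrow> ('v, 'e, 'a) cell2 list \<Rightarrow>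
    ('v, 'e, 'a) cell2 \<Rightarrow> ('v, 'e, 'a) cell2 list \<Rightarrow> bool" where
  "sd_diagram P r \<psi> F Fs G Gs \<longleftrightarrow> confluence_diagram P F Fs G Gs \<and>
     (\<forall>k \<in> \<psi> ` set Fs. (k, \<psi> F) \<in> r) \<and> (\<forall>k \<in> \<psi> ` set Gs. (k, \<psi> G) \<in> r)"

definition strictly_decreasing :: "('v, 'e, 'a) polygraph2 \<Rightarrow> ('w \<times> 'w) set \<Rightarrow>
    (('v, 'e, 'a) cell2 \<Rightarrow> 'w) \<Rightarrow> bool" where
  "strictly_decreasing P r \<psi> \<longleftrightarrow> two_polygraph P \<and> wf r \<and> trans r \<and>
     (\<forall>F G. local_branching P F G \<longrightarrow> (\<exists>Fs Gs. sd_diagram P r \<psi> F Fs G Gs))"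

definition compatible_with_contexts :: "('v, 'e, 'a) polygraph2 \<Rightarrow> ('w \<times> 'w) set \<Rightarrow>
    (('v, 'e, 'a) cell2 \<Rightarrow> 'w) \<Rightarrow> bool" where
  "compatible_with_contexts P r \<psi> \<longleftrightarrow>
     (\<forall>F Fs G Gs u v. sd_diagram P r \<psi> F Fs G Gs \<longrightarrow> composable_ctx P u F v \<longrightarrow>
        sd_diagram P r \<psi>
          (whisker P False u F v) (map (\<lambda>H. whisker P False u H v) Fs)
          (whisker P False u G v) (map (\<lambda>H. whisker P False u H v) Gs))"


section \<open>Globular extensions and coherent presentations\<close>

record ('c, 'x) globular_ext =
  gens3 :: "'c set"
  gsrc2 :: "'c \<Rightarrow> 'x"
  gtgt2 :: "'c \<Rightarrow> 'x"

definition parallel2 :: "('v, 'e, 'a) polygraph2 \<Rightarrow>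
    ('v, 'e, 'a) cell2 \<Rightarrow> ('v, 'e, 'a) cell2 \<Rightarrow> bool" where
  "parallel2 P F G \<longleftrightarrow> src1 P F = src1 P G \<and> tgt1 P F = tgt1 P G"

definition globular_extension :: "('v, 'e, 'a) polygraph2 \<Rightarrow>
    ('c, ('v, 'e, 'a) cell2) globular_ext \<Rightarrow> bool" where
  "globular_extension P \<Gamma> \<longleftrightarrow> (\<forall>A \<in> gens3 \<Gamma>.
     gsrc2 \<Gamma> A \<in> cells2 P True \<and> gtgt2 \<Gamma> A \<in> cells2 P True \<and>
     parallel2 P (gsrc2 \<Gamma> A) (gtgt2 \<Gamma> A))"

inductive cong_ext :: "('v, 'e, 'a) polygraph2 \<Rightarrow> ('c, ('v, 'e, 'a) cell2) globular_ext \<Rightarrow>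
    ('v, 'e, 'a) cell2 \<Rightarrow> ('v, 'e, 'a) cell2 \<Rightarrow> bool" for P \<Gamma> where
  gen: "A \<in> gens3 \<Gamma> \<Longrightarrow> cong_ext P \<Gamma> (gsrc2 \<Gamma> A) (gtgt2 \<Gamma> A)"
| refl: "F \<in> cells2 P True \<Longrightarrow> cong_ext P \<Gamma> F F"
| sym: "cong_ext P \<Gamma> F G \<Longrightarrow> cong_ext P \<Gamma> G F"
| trans: "cong_ext P \<Gamma> F G \<Longrightarrow> cong_ext P \<Gamma> G H \<Longrightarrow> cong_ext P \<Gamma> F H"
| hcomp: "cong_ext P \<Gamma> F F' \<Longrightarrow> cong_ext P \<Gamma> G G' \<Longrightarrow> tgt0 (src1 P F) = src0 (src1 P G) \<Longrightarrow>
    cong_ext P \<Gamma> (hcomp P True F G) (hcomp P True F' G')"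
| vcomp: "cong_ext P \<Gamma> F F' \<Longrightarrow> cong_ext P \<Gamma> G G' \<Longrightarrow> tgt1 P F = src1 P G \<Longrightarrow>
    cong_ext P \<Gamma> (vcomp P True F G) (vcomp P True F' G')"

text \<open>The free (3,1)-category: formal composites of 3-cells over the 2-cells of the free
  (2,1)-category, modulo the axioms of strict 3-categories and invertibility for the composition
  \<open>C2\<close> along 2-cells.  \<open>C0\<close> and \<open>C1\<close> compose along 0-cells and 1-cells.\<close>

datatype ('c, 'x) expr3 =
    Gen3 'c
  | Idn3 'x
  | C0 "('c, 'x) expr3" "('c, 'x) expr3"
  | C1 "('c, 'x) expr3" "('c, 'x) expr3"
  | C2 "('c, 'x) expr3" "('c, 'x) expr3"
  | Inv3 "('c, 'x) expr3"

fun esrc2 :: "('v, 'e, 'a) polygraph2 \<Rightarrow> ('c, ('v, 'e, 'a) cell2) globular_ext \<Rightarrow>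
    ('c, ('v, 'e, 'a) cell2) expr3 \<Rightarrow> ('v, 'e, 'a) cell2"
  and etgt2 :: "('v, 'e, 'a) polygraph2 \<Rightarrow> ('c, ('v, 'e, 'a) cell2) globular_ext \<Rightarrow>
    ('c, ('v, 'e, 'a) cell2) expr3 \<Rightarrow> ('v, 'e, 'a) cell2" where
  "esrc2 P \<Gamma> (Gen3 A) = gsrc2 \<Gamma> A"
| "esrc2 P \<Gamma> (Idn3 F) = F"
| "esrc2 P \<Gamma> (C0 x y) = hcomp P True (esrc2 P \<Gamma> x) (esrc2 P \<Gamma> y)"
| "esrc2 P \<Gamma> (C1 x y) = vcomp P True (esrc2 P \<Gamma> x) (esrc2 P \<Gamma> y)"
| "esrc2 P \<Gamma> (C2 x y) = esrc2 P \<Gamma> x"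
| "esrc2 P \<Gamma> (Inv3 x) = etgt2 P \<Gamma> x"
| "etgt2 P \<Gamma> (Gen3 A) = gtgt2 \<Gamma> A"
| "etgt2 P \<Gamma> (Idn3 F) = F"
| "etgt2 P \<Gamma> (C0 x y) = hcomp P True (etgt2 P \<Gamma> x) (etgt2 P \<Gamma> y)"
| "etgt2 P \<Gamma> (C1 x y) = vcomp P True (etgt2 P \<Gamma> x) (etgt2 P \<Gamma> y)"
| "etgt2 P \<Gamma> (C2 x y) = etgt2 P \<Gamma> y"
| "etgt2 P \<Gamma> (Inv3 x) = esrc2 P \<Gamma> x"

primrec wf3 :: "('v, 'e, 'a) polygraph2 \<Rightarrow> ('c, ('v, 'e, 'a) cell2) globular_ext \<Rightarrow>
    ('c, ('v, 'e, 'a) cell2) expr3 \<Rightarrow> bool" where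
  "wf3 P \<Gamma> (Gen3 A) \<longleftrightarrow> A \<in> gens3 \<Gamma>"
| "wf3 P \<Gamma> (Idn3 F) \<longleftrightarrow> F \<in> cells2 P True"
| "wf3 P \<Gamma> (C0 x y) \<longleftrightarrow> wf3 P \<Gamma> x \<and> wf3 P \<Gamma> y \<and>
     tgt0 (src1 P (esrc2 P \<Gamma> x)) = src0 (src1 P (esrc2 P \<Gamma> y))"
| "wf3 P \<Gamma> (C1 x y) \<longleftrightarrow> wf3 P \<Gamma> x \<and> wf3 P \<Gamma> y \<and>
     tgt1 P (esrc2 P \<Gamma> x) = src1 P (esrc2 P \<Gamma> y)"
| "wf3 P \<Gamma> (C2 x y) \<longleftrightarrow> wf3 P \<Gamma> x \<and> wf3 P \<Gamma> y \<and> etgt2 P \<Gamma> x = esrc2 P \<Gamma> y"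
| "wf3 P \<Gamma> (Inv3 x) \<longleftrightarrow> wf3 P \<Gamma> x"

inductive eq3 :: "('v, 'e, 'a) polygraph2 \<Rightarrow> ('c, ('v, 'e, 'a) cell2) globular_ext \<Rightarrow>
    ('c, ('v, 'e, 'a) cell2) expr3 \<Rightarrow> ('c, ('v, 'e, 'a) cell2) expr3 \<Rightarrow> bool" for P \<Gamma> where
  refl: "wf3 P \<Gamma> x \<Longrightarrow> eq3 P \<Gamma> x x"
| sym: "eq3 P \<Gamma> x y \<Longrightarrow> eq3 P \<Gamma> y x"
| trans: "eq3 P \<Gamma> x y \<Longrightarrow> eq3 P \<Gamma> y z \<Longrightarrow> eq3 P \<Gamma> x z"
| cong_C0: "eq3 P \<Gamma> x x' \<Longrightarrow> eq3 P \<Gamma> y y' \<Longrightarrow> wf3 P \<Gamma> (C0 x y) \<Longrightarrow> eq3 P \<Gamma> (C0 x y) (C0 x' y')"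
| cong_C1: "eq3 P \<Gamma> x x' \<Longrightarrow> eq3 P \<Gamma> y y' \<Longrightarrow> wf3 P \<Gamma> (C1 x y) \<Longrightarrow> eq3 P \<Gamma> (C1 x y) (C1 x' y')"
| cong_C2: "eq3 P \<Gamma> x x' \<Longrightarrow> eq3 P \<Gamma> y y' \<Longrightarrow> wf3 P \<Gamma> (C2 x y) \<Longrightarrow> eq3 P \<Gamma> (C2 x y) (C2 x' y')"
| cong_Inv3: "eq3 P \<Gamma> x x' \<Longrightarrow> eq3 P \<Gamma> (Inv3 x) (Inv3 x')"
| assoc_C0: "wf3 P \<Gamma> (C0 (C0 x y) z) \<Longrightarrow> eq3 P \<Gamma> (C0 (C0 x y) z) (C0 x (C0 y z))"
| assoc_C1: "wf3 P \<Gamma> (C1 (C1 x y) z) \<Longrightarrow> eq3 P \<Gamma> (C1 (C1 x y) z) (C1 x (C1 y z))"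
| assoc_C2: "wf3 P \<Gamma> (C2 (C2 x y) z) \<Longrightarrow> eq3 P \<Gamma> (C2 (C2 x y) z) (C2 x (C2 y z))"
| unitl_C0: "wf3 P \<Gamma> x \<Longrightarrow>
    eq3 P \<Gamma> (C0 (Idn3 (ident1 P True (ident0 (src0 (src1 P (esrc2 P \<Gamma> x)))))) x) x"
| unitr_C0: "wf3 P \<Gamma> x \<Longrightarrow>
    eq3 P \<Gamma> (C0 x (Idn3 (ident1 P True (ident0 (tgt0 (src1 P (esrc2 P \<Gamma> x))))))) x"
| unitl_C1: "wf3 P \<Gamma> x \<Longrightarrow> eq3 P \<Gamma> (C1 (Idn3 (ident1 P True (src1 P (esrc2 P \<Gamma> x)))) x) x"
| unitr_C1: "wf3 P \<Gamma> x \<Longrightarrow> eq3 P \<Gamma> (C1 x (Idn3 (ident1 P True (tgt1 P (esrc2 P \<Gamma> x))))) x"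
| unitl_C2: "wf3 P \<Gamma> x \<Longrightarrow> eq3 P \<Gamma> (C2 (Idn3 (esrc2 P \<Gamma> x)) x) x"
| unitr_C2: "wf3 P \<Gamma> x \<Longrightarrow> eq3 P \<Gamma> (C2 x (Idn3 (etgt2 P \<Gamma> x))) x"
| id_C0: "wf3 P \<Gamma> (C0 (Idn3 F) (Idn3 G)) \<Longrightarrow>
    eq3 P \<Gamma> (C0 (Idn3 F) (Idn3 G)) (Idn3 (hcomp P True F G))"
| id_C1: "wf3 P \<Gamma> (C1 (Idn3 F) (Idn3 G)) \<Longrightarrow>
    eq3 P \<Gamma> (C1 (Idn3 F) (Idn3 G)) (Idn3 (vcomp P True F G))"
| exchange_01: "wf3 P \<Gamma> (C0 (C1 x y) (C1 z w)) \<Longrightarrow>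
    eq3 P \<Gamma> (C0 (C1 x y) (C1 z w)) (C1 (C0 x z) (C0 y w))"
| exchange_02: "wf3 P \<Gamma> (C0 (C2 x y) (C2 z w)) \<Longrightarrow>
    eq3 P \<Gamma> (C0 (C2 x y) (C2 z w)) (C2 (C0 x z) (C0 y w))"
| exchange_12: "wf3 P \<Gamma> (C1 (C2 x y) (C2 z w)) \<Longrightarrow>
    eq3 P \<Gamma> (C1 (C2 x y) (C2 z w)) (C2 (C1 x z) (C1 y w))"
| invr: "wf3 P \<Gamma> x \<Longrightarrow> eq3 P \<Gamma> (C2 x (Inv3 x)) (Idn3 (esrc2 P \<Gamma> x))"
| invl: "wf3 P \<Gamma> x \<Longrightarrow> eq3 P \<Gamma> (C2 (Inv3 x) x) (Idn3 (etgt2 P \<Gamma> x))"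

type_synonym ('v, 'e, 'a, 'c) cell3 = "('c, ('v, 'e, 'a) cell2) expr3 set"

definition cells3 :: "('v, 'e, 'a) polygraph2 \<Rightarrow> ('c, ('v, 'e, 'a) cell2) globular_ext \<Rightarrow>
    ('v, 'e, 'a, 'c) cell3 set" where
  "cells3 P \<Gamma> = (\<lambda>x. {y. eq3 P \<Gamma> x y}) ` {x. wf3 P \<Gamma> x}"

definition src2 :: "('v, 'e, 'a) polygraph2 \<Rightarrow> ('c, ('v, 'e, 'a) cell2) globular_ext \<Rightarrow>
    ('v, 'e, 'a, 'c) cell3 \<Rightarrow> ('v, 'e, 'a) cell2" where
  "src2 P \<Gamma> X = the_elem (esrc2 P \<Gamma> ` X)"

definition tgt2 :: "('v, 'e, 'a) polygraph2 \<Rightarrow> ('c, ('v, 'e, 'a) cell2) globular_ext \<Rightarrow>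
    ('v, 'e, 'a, 'c) cell3 \<Rightarrow> ('v, 'e, 'a) cell2" where
  "tgt2 P \<Gamma> X = the_elem (etgt2 P \<Gamma> ` X)"

text \<open>The category presented by \<open>(P, \<Gamma>)\<close> is by definition the one presented by \<open>P\<close>, so
  the only condition to state is the filling of 2-spheres.\<close>

definition coherent_presentation :: "('v, 'e, 'a) polygraph2 \<Rightarrow>
    ('c, ('v, 'e, 'a) cell2) globular_ext \<Rightarrow> bool" where
  "coherent_presentation P \<Gamma> \<longleftrightarrow> two_polygraph P \<and> globular_extension P \<Gamma> \<and>
     (\<forall>F \<in> cells2 P True. \<forall>G \<in> cells2 P True. parallel2 P F G \<longrightarrow>
        (\<exists>X \<in> cells3 P \<Gamma>. src2 P \<Gamma> X = F \<and> tgt2 P \<Gamma> X = G))"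

definition peiffer_decreasing :: "('v, 'e, 'a) polygraph2 \<Rightarrow> ('w \<times> 'w) set \<Rightarrow>
    (('v, 'e, 'a) cell2 \<Rightarrow> 'w) \<Rightarrow> ('c, ('v, 'e, 'a) cell2) globular_ext \<Rightarrow> bool" where
  "peiffer_decreasing P r \<psi> \<Gamma> \<longleftrightarrow> strictly_decreasing P r \<psi> \<and> globular_extension P \<Gamma> \<and>
     (\<forall>F G. peiffer_pair P F G \<longrightarrow>
       (\<exists>Fs Gs. sd_diagram P r \<psi> (peiffer_left P F G) Fs (peiffer_right P F G) Gs \<and>
          cong_ext P \<Gamma>
            (vcomp P True
              (incl2 P (hcomp P False (ident1 P False (tgt1 P F)) G))
              (inv2 P (incl2 P (hcomp P False F (ident1 P False (tgt1 P G))))))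
            (vcomp P True
              (incl2 P (seq_cell P (tgt1 P (peiffer_left P F G)) Fs))
              (inv2 P (incl2 P (seq_cell P (tgt1 P (peiffer_right P F G)) Gs))))))"


section \<open>Loops\<close>

definition loops :: "('v, 'e, 'a) polygraph2 \<Rightarrow> ('v, 'e, 'a) cell2 set" where
  "loops P = {F \<in> cells2 P False. src1 P F = tgt1 P F}"

definition rotated :: "('v, 'e, 'a) polygraph2 \<Rightarrow>
    ('v, 'e, 'a) cell2 \<Rightarrow> ('v, 'e, 'a) cell2 \<Rightarrow> bool" where
  "rotated P F G \<longleftrightarrow> (\<exists>p q Fs Gs. rseq P p Fs q \<and> rseq P q Gs p \<and>
     F = seq_cell P p (Fs @ Gs) \<and> G = seq_cell P q (Gs @ Fs))"

text \<open>A 2-cell can have several decompositions into steps, hence the transitive closure.\<close>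

definition loop_equiv :: "('v, 'e, 'a) polygraph2 \<Rightarrow>
    ('v, 'e, 'a) cell2 \<Rightarrow> ('v, 'e, 'a) cell2 \<Rightarrow> bool" where
  "loop_equiv P = (rotated P)\<^sup>*\<^sup>*"

definition minimal_1comp :: "('v, 'e, 'a) polygraph2 \<Rightarrow> ('v, 'e, 'a) cell2 \<Rightarrow> bool" where
  "minimal_1comp P F \<longleftrightarrow>
     (\<forall>G \<in> cells2 P False. \<forall>H \<in> loops P. \<forall>K \<in> cells2 P False.
        tgt1 P G = src1 P H \<longrightarrow> tgt1 P H = src1 P K \<longrightarrow>
        F = vcomp P False (vcomp P False G H) K \<longrightarrow>
        H \<in> ident1 P False ` cells1 P \<or> H = F)"

definition minimal_ctx :: "('v, 'e, 'a) polygraph2 \<Rightarrow> ('v, 'e, 'a) cell2 \<Rightarrow> bool" where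
  "minimal_ctx P F \<longleftrightarrow>
     \<not> (\<exists>u v. \<exists>G \<in> loops P. u \<notin> range ident0 \<and> v \<notin> range ident0 \<and>
          composable_ctx P u G v \<and> F = whisker P False u G v)"

definition elementary_loops :: "('v, 'e, 'a) polygraph2 \<Rightarrow> ('v, 'e, 'a) cell2 set" where
  "elementary_loops P = {F \<in> loops P. minimal_1comp P F \<and> minimal_ctx P F}"

definition loop_extension :: "('v, 'e, 'a) polygraph2 \<Rightarrow>
    ('c, ('v, 'e, 'a) cell2) globular_ext \<Rightarrow> bool" where
  "loop_extension P \<Gamma> \<longleftrightarrow> globular_extension P \<Gamma> \<and>
     (\<exists>R A. R \<subseteq> elementary_loops P \<and>
        (\<forall>F \<in> elementary_loops P. \<exists>!\<alpha>. \<alpha> \<in> R \<and> loop_equiv P F \<alpha>) \<and>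
        bij_betw A R (gens3 \<Gamma>) \<and>
        (\<forall>\<alpha> \<in> R. gsrc2 \<Gamma> (A \<alpha>) = incl2 P \<alpha> \<and> gtgt2 \<Gamma> (A \<alpha>) = ident1 P True (src1 P \<alpha>)))"


section \<open>Squier's completion\<close>

definition generating_sd_confluences :: "('v, 'e, 'a) polygraph2 \<Rightarrow> ('w \<times> 'w) set \<Rightarrow>
    (('v, 'e, 'a) cell2 \<Rightarrow> 'w) \<Rightarrow> ('c, ('v, 'e, 'a) cell2) globular_ext \<Rightarrow> bool" where
  "generating_sd_confluences P r \<psi> \<Gamma> \<longleftrightarrow> globular_extension P \<Gamma> \<and>
     (\<exists>D. bij_betw D (critical_branchings P) (gens3 \<Gamma>) \<and>
        (\<forall>B \<in> critical_branchings P. \<exists>F G Fs Gs. B = {F, G} \<and>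
           sd_diagram P r \<psi> F Fs G Gs \<and>
           gsrc2 \<Gamma> (D B) = incl2 P (seq_cell P (src1 P F) (F # Fs)) \<and>
           gtgt2 \<Gamma> (D B) = incl2 P (seq_cell P (src1 P G) (G # Gs))))"

text \<open>No disjointness of the two families has to be required: a cell of the first one has a
  target of positive length, a cell of the second one has an identity as target.\<close>

definition sd_squier_completion :: "('v, 'e, 'a) polygraph2 \<Rightarrow> ('w \<times> 'w) set \<Rightarrow>
    (('v, 'e, 'a) cell2 \<Rightarrow> 'w) \<Rightarrow> ('c, ('v, 'e, 'a) cell2) globular_ext \<Rightarrow> bool" where
  "sd_squier_completion P r \<psi> \<Gamma> \<longleftrightarrow>
     (\<exists>C L. gens3 \<Gamma> = C \<union> L \<and>
        generating_sd_confluences P r \<psi> (\<Gamma>\<lparr>gens3 := C\<rparr>) \<and>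
        loop_extension P (\<Gamma>\<lparr>gens3 := L\<rparr>))"

end

theory Submission
  imports Defs
begin

text \<open>
  Modulo the 3-cells, the 2-cells of the free (2,1)-category form a groupoid generated by the
  rewriting steps, in which every local branching is closed by a commuting strictly decreasing
  diagram and every 2-loop is trivial.  Termination is not available, so instead of comparing
  2-cells through normal forms one enlarges, by Zorn's lemma, a down-closed set \<open>D\<close> of labels for
  which the zigzags of steps labelled in \<open>D\<close> form a confluent simply connected subgroupoid.

  Let \<open>\<alpha>\<close> be minimal outside \<open>D\<close>.  Strict decreasingness forces a step labelled \<open>\<alpha>\<close> to equal a
  \<open>D\<close>-zigzag as soon as its source admits a step labelled in \<open>D\<close>, and any two steps labelled
  \<open>\<alpha>\<close> with the same source to differ by a \<open>D\<close>-zigzag.  By confluence a \<open>D\<close>-component contains at most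
  one \<open>D\<close>-normal form, so contracting the components leaves a graph in which every vertex
  has at most one outgoing edge.  The only cycles of such a graph are directed ones; these are
  represented by loops of steps, hence trivial, and \<open>D \<union> {\<alpha>}\<close> has the same property as \<open>D\<close>.
\<close>

section \<open>Strictly decreasing generators of a groupoid\<close>

locale groupoid =
  fixes Obj :: "'o set"
    and hom :: "'o \<Rightarrow> 'o \<Rightarrow> 'm set"
    and one :: "'o \<Rightarrow> 'm"
    and comp :: "'m \<Rightarrow> 'm \<Rightarrow> 'm" (infixr "\<cdot>" 70)
    and inv :: "'m \<Rightarrow> 'm"
  assumes hom_Obj: "x \<in> hom u v \<Longrightarrow> u \<in> Obj \<and> v \<in> Obj"
    and one_hom [simp, intro]: "u \<in> Obj \<Longrightarrow> one u \<in> hom u u"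
    and comp_hom [intro]: "x \<in> hom u v \<Longrightarrow> y \<in> hom v w \<Longrightarrow> x \<cdot> y \<in> hom u w"
    and inv_hom [intro]: "x \<in> hom u v \<Longrightarrow> inv x \<in> hom v u"
    and assoc: "x \<in> hom u v \<Longrightarrow> y \<in> hom v w \<Longrightarrow> z \<in> hom w t \<Longrightarrow> (x \<cdot> y) \<cdot> z = x \<cdot> y \<cdot> z"
    and one_left: "x \<in> hom u v \<Longrightarrow> one u \<cdot> x = x"
    and one_right: "x \<in> hom u v \<Longrightarrow> x \<cdot> one v = x"
    and inv_right: "x \<in> hom u v \<Longrightarrow> x \<cdot> inv x = one u"
    and inv_left: "x \<in> hom u v \<Longrightarrow> inv x \<cdot> x = one v"
begin

section \<open>Cancellation and inverses in groupoids\<close>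

lemma assoc3:
  assumes "x \<in> hom u v" "y \<in> hom v w" "z \<in> hom w a" "p \<in> hom a b"
  shows "x \<cdot> y \<cdot> z \<cdot> p = (x \<cdot> y \<cdot> z) \<cdot> p"
  using assoc[OF assms(1) comp_hom[OF assms(2,3)] assms(4)] assoc[OF assms(2-4)] by simp

lemma cancel_left: "x \<in> hom u v \<Longrightarrow> y \<in> hom v w \<Longrightarrow> inv x \<cdot> x \<cdot> y = y"
  by (simp only: assoc[symmetric, OF inv_hom] inv_left one_left)

lemma cancel_right: "x \<in> hom u v \<Longrightarrow> y \<in> hom u w \<Longrightarrow> x \<cdot> inv x \<cdot> y = y"
  by (simp only: assoc[symmetric, OF _ inv_hom] inv_right one_left)

lemma left_solve: "x \<in> hom u v \<Longrightarrow> y \<in> hom v w \<Longrightarrow> x \<cdot> y = z \<Longrightarrow> y = inv x \<cdot> z"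
  by (auto simp: cancel_left)

lemma right_solve:
  assumes "x \<in> hom u v" "y \<in> hom v w" "x \<cdot> y = z"
  shows "x = z \<cdot> inv y"
proof -
  have "(x \<cdot> y) \<cdot> inv y = x"
    using assms(1,2) by (simp only: assoc[OF _ _ inv_hom] inv_right one_right)
  with assms show ?thesis by simp
qed

lemma right_fixed_one:
  assumes "x \<in> hom u u" "y \<in> hom u v" "x \<cdot> y = y"
  shows "x = one u"
  using right_solve[OF assms(1,2,3)] inv_right[OF assms(2)] by simp

lemma inv_one: "u \<in> Obj \<Longrightarrow> inv (one u) = one u"
  using one_left[OF inv_hom[OF one_hom]] inv_right[OF one_hom] by simp

lemma inv_inv: "x \<in> hom u v \<Longrightarrow> inv (inv x) = x"
  using left_solve[OF inv_hom inv_hom[OF inv_hom]] cancel_left cancel_right one_right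
    inv_left inv_right inv_hom
  by (metis (no_types))

lemma inv_comp:
  assumes "x \<in> hom u v" "y \<in> hom v w"
  shows "inv (x \<cdot> y) = inv y \<cdot> inv x"
proof -
  have "(x \<cdot> y) \<cdot> inv y \<cdot> inv x = one u"
    using assoc[OF assms comp_hom[OF inv_hom[OF assms(2)] inv_hom[OF assms(1)]]]
      cancel_right[OF assms(2) inv_hom[OF assms(1)]] inv_right[OF assms(1)] by simp
  then show ?thesis
    using left_solve[of "x \<cdot> y" u w "inv y \<cdot> inv x" u "one u"] assms
    by (metis comp_hom inv_hom one_right)
qed

text \<open>Multiplied on the right by \<open>inv y\<close>, the left side becomes
  \<open>l \<cdot> a \<cdot> inv c\<close>, which the first square reduces to \<open>b\<close>. This
  turns the form in which Peiffer decreasingness is stated into commutation of the confluence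
  diagram.\<close>

lemma peiffer_square:
  assumes "l \<in> hom u v" "a \<in> hom v w" "b \<in> hom u v'" "c \<in> hom v' w"
    "x \<in> hom v q" "y \<in> hom v' q"
    and "l \<cdot> a = b \<cdot> c" "a \<cdot> inv c = x \<cdot> inv y"
  shows "l \<cdot> x = b \<cdot> y"
proof -
  have "l \<cdot> x = l \<cdot> (x \<cdot> inv y) \<cdot> y"
    using assms(5,6) by (simp only: assoc[OF _ inv_hom] inv_left one_right)
  also have "\<dots> = l \<cdot> (a \<cdot> inv c) \<cdot> y" using assms(8) by simp
  also have "\<dots> = (l \<cdot> a) \<cdot> inv c \<cdot> y"
    using assoc[OF assms(1,2) comp_hom[OF inv_hom[OF assms(4)] assms(6)]]
      assoc[OF assms(2) inv_hom[OF assms(4)] assms(6)] by simp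
  also have "\<dots> = b \<cdot> c \<cdot> inv c \<cdot> y"
    using assms(7) assoc[OF assms(3,4) comp_hom[OF inv_hom[OF assms(4)] assms(6)]] by simp
  also have "\<dots> = b \<cdot> y" using cancel_right[OF assms(4,6)] by simp
  finally show ?thesis .
qed

text \<open>A one-sided inverse in a groupoid is two-sided. This allows the base point of a closed
  path to be moved.\<close>

lemma conjugate_one:
  assumes "x \<in> hom u v" "y \<in> hom v u" "y \<cdot> x = one v"
  shows "x \<cdot> y = one u"
  by (metis assms inv_right left_solve inv_inv inv_hom one_right)

end

text \<open>Steps are kept apart from their values \<open>ev f\<close>, because labels belong to
  steps and distinct steps may have the same value.\<close>

locale decreasing_groupoid = groupoid +
  fixes S :: "'s set"
    and s t :: "'s \<Rightarrow> 'a"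
    and ev :: "'s \<Rightarrow> 'b"
    and lab :: "'s \<Rightarrow> 'w"
    and r :: "('w \<times> 'w) set"
  assumes ev_hom: "f \<in> S \<Longrightarrow> ev f \<in> hom (s f) (t f)"
    and wf_r: "wf r"
begin

text \<open>Zigzags are recorded only through their endpoints and their value, so zigzags with equal
  ends and equal value are identified. The relation \<open>pos\<close> below allows forward steps
  only and corresponds to rewriting sequences.\<close>

inductive zig :: "'w set \<Rightarrow> 'a \<Rightarrow> 'b \<Rightarrow> 'a \<Rightarrow> bool" for D where
  zig_one: "u \<in> Obj \<Longrightarrow> zig D u (one u) u"
| zig_step: "f \<in> S \<Longrightarrow> lab f \<in> D \<Longrightarrow> zig D (t f) x v \<Longrightarrow> zig D (s f) (ev f \<cdot> x) v"
| zig_back: "f \<in> S \<Longrightarrow> lab f \<in> D \<Longrightarrow> zig D (s f) x v \<Longrightarrow> zig D (t f) (inv (ev f) \<cdot> x) v"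

inductive pos :: "'w set \<Rightarrow> 'a \<Rightarrow> 'b \<Rightarrow> 'a \<Rightarrow> bool" for D where
  pos_one: "u \<in> Obj \<Longrightarrow> pos D u (one u) u"
| pos_step: "f \<in> S \<Longrightarrow> lab f \<in> D \<Longrightarrow> pos D (t f) x v \<Longrightarrow> pos D (s f) (ev f \<cdot> x) v"

section \<open>Elementary properties of zigzags and directed paths\<close>

lemma zig_hom: "zig D u x v \<Longrightarrow> x \<in> hom u v"
  by (induction rule: zig.induct) (auto intro: ev_hom)

lemma pos_zig: "pos D u x v \<Longrightarrow> zig D u x v"
  by (induction rule: pos.induct) (auto intro: zig.intros)

lemma pos_hom: "pos D u x v \<Longrightarrow> x \<in> hom u v"
  using pos_zig zig_hom by blast

lemma zig_mono: "zig D u x v \<Longrightarrow> D \<subseteq> D' \<Longrightarrow> zig D' u x v"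
  by (induction rule: zig.induct) (auto intro: zig.intros)

lemma pos_mono: "pos D u x v \<Longrightarrow> D \<subseteq> D' \<Longrightarrow> pos D' u x v"
  by (induction rule: pos.induct) (auto intro: pos.intros)

lemma zig_trans: "zig D u x v \<Longrightarrow> zig D v y w \<Longrightarrow> zig D u (x \<cdot> y) w"
proof (induction rule: zig.induct)
  case (zig_one u)
  then show ?case using one_left zig_hom by metis
next
  case (zig_step f x v)
  then have "zig D (s f) (ev f \<cdot> x \<cdot> y) w" by (auto intro: zig.zig_step)
  then show ?case using zig_step assoc ev_hom zig_hom by metis
next
  case (zig_back f x v)
  then have "zig D (t f) (inv (ev f) \<cdot> x \<cdot> y) w" by (auto intro: zig.zig_back)
  then show ?case using zig_back assoc ev_hom zig_hom inv_hom by metis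
qed

lemma pos_trans: "pos D u x v \<Longrightarrow> pos D v y w \<Longrightarrow> pos D u (x \<cdot> y) w"
proof (induction rule: pos.induct)
  case (pos_one u)
  then show ?case using one_left pos_hom by metis
next
  case (pos_step f x v)
  then have "pos D (s f) (ev f \<cdot> x \<cdot> y) w" by (auto intro: pos.pos_step)
  then show ?case using pos_step assoc ev_hom pos_hom by metis
qed

lemma zig_single: "f \<in> S \<Longrightarrow> lab f \<in> D \<Longrightarrow> zig D (s f) (ev f) (t f)"
  by (metis ev_hom hom_Obj one_right zig_one zig_step)

lemma pos_single: "f \<in> S \<Longrightarrow> lab f \<in> D \<Longrightarrow> pos D (s f) (ev f) (t f)"
  by (metis ev_hom hom_Obj one_right pos_one pos_step)

lemma zig_inv: "zig D u x v \<Longrightarrow> zig D v (inv x) u"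
proof (induction rule: zig.induct)
  case (zig_one u)
  then show ?case by (simp add: inv_one zig.zig_one)
next
  case (zig_step f x v)
  have "zig D (t f) (inv (ev f)) (s f)"
    using zig_step by (metis ev_hom hom_Obj inv_hom one_right zig.zig_one zig_back)
  then show ?case
    using zig_trans[OF zig_step(4)] inv_comp[OF ev_hom[OF zig_step(1)] zig_hom[OF zig_step(3)]]
    by simp
next
  case (zig_back f x v)
  have "inv (inv (ev f) \<cdot> x) = inv x \<cdot> ev f"
    using zig_back inv_comp[of "inv (ev f)" "t f" "s f" x v] ev_hom zig_hom inv_inv
    by (metis inv_hom)
  then show ?case
    using zig_back zig_trans zig_single by metis
qed

text \<open>Uniqueness of values is the goal; the other two clauses keep the induction going.
  Down-closure keeps the completions of steps labelled in \<open>D\<close> inside \<open>D\<close>,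
  and joinability gives each component at most one normal form.\<close>

definition good :: "'w set \<Rightarrow> bool" where
  "good D \<longleftrightarrow> (\<forall>k l. l \<in> D \<longrightarrow> (k, l) \<in> r \<longrightarrow> k \<in> D) \<and>
     (\<forall>u x y v. zig D u x v \<longrightarrow> zig D u y v \<longrightarrow> x = y) \<and>
     (\<forall>u x v. zig D u x v \<longrightarrow> (\<exists>w a b. pos D u a w \<and> pos D v b w))"

lemma good_empty: "good {}"
proof -
  have "x = one u \<and> v = u \<and> u \<in> Obj" if "zig {} u x v" for u x v
    using that by (induction rule: zig.induct) auto
  then show ?thesis unfolding good_def by (blast intro: pos_one)
qed

text \<open>A zigzag carries finitely many labels, so one member of the chain contains them all. The
  induction takes the larger of the members serving the first step and the rest.\<close>

lemma zig_Union:
  assumes "C \<noteq> {}" "\<And>X Y. X \<in> C \<Longrightarrow> Y \<in> C \<Longrightarrow> X \<subseteq> Y \<or> Y \<subseteq> X"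
  shows "zig (\<Union>C) u x v \<Longrightarrow> \<exists>D\<in>C. zig D u x v"
proof (induction rule: zig.induct)
  case (zig_one u)
  then show ?case using assms(1) zig.zig_one by blast
next
  case (zig_step f x v)
  then obtain X Y where "X \<in> C" "lab f \<in> X" "Y \<in> C" "zig Y (t f) x v" by blast
  then show ?case using assms(2)[of X Y] zig_step(1) zig_mono zig.zig_step by (metis subsetD)
next
  case (zig_back f x v)
  then obtain X Y where "X \<in> C" "lab f \<in> X" "Y \<in> C" "zig Y (s f) x v" by blast
  then show ?case using assms(2)[of X Y] zig_back(1) zig_mono zig.zig_back by (metis subsetD)
qed

lemma good_Union:
  assumes C: "C \<noteq> {}" "\<And>X Y. X \<in> C \<Longrightarrow> Y \<in> C \<Longrightarrow> X \<subseteq> Y \<or> Y \<subseteq> X"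
    and good: "\<And>X. X \<in> C \<Longrightarrow> good X"
  shows "good (\<Union>C)"
  unfolding good_def
proof (intro conjI allI impI)
  fix k l assume "l \<in> \<Union>C" "(k, l) \<in> r"
  then show "k \<in> \<Union>C" using good unfolding good_def by blast
next
  fix u x y v assume "zig (\<Union>C) u x v" "zig (\<Union>C) u y v"
  then obtain X Y where "X \<in> C" "zig X u x v" "Y \<in> C" "zig Y u y v"
    using zig_Union[OF C] by metis
  moreover obtain Z where "Z \<in> C" "X \<subseteq> Z" "Y \<subseteq> Z"
    using calculation C(2)[of X Y] by blast
  ultimately show "x = y" using good[of Z] zig_mono unfolding good_def by metis
next
  fix u x v assume "zig (\<Union>C) u x v"
  then obtain X where X: "X \<in> C" "zig X u x v" using zig_Union[OF C] by blast
  then obtain w a b where "pos X u a w" "pos X v b w"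
    using good[of X] unfolding good_def by blast
  then show "\<exists>w a b. pos (\<Union>C) u a w \<and> pos (\<Union>C) v b w"
    using X(1) pos_mono by (meson Union_upper)
qed

section \<open>Adding a minimal label to a good set\<close>

context
  fixes D :: "'w set" and \<alpha> :: 'w
  assumes good: "good D" and \<alpha>: "\<alpha> \<notin> D" "\<And>k. (k, \<alpha>) \<in> r \<Longrightarrow> k \<in> D"
    and local: "\<And>f g. f \<in> S \<Longrightarrow> g \<in> S \<Longrightarrow> s f = s g \<Longrightarrow>
      \<exists>x y w. pos {k. (k, lab f) \<in> r} (t f) x w \<and> pos {k. (k, lab g) \<in> r} (t g) y w \<and>
        ev f \<cdot> x = ev g \<cdot> y"
    and loop: "\<And>u x. pos UNIV u x u \<Longrightarrow> x = one u"
begin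

lemma down: "l \<in> D \<Longrightarrow> {k. (k, l) \<in> r} \<subseteq> D"
  using good unfolding good_def by blast

lemma zig_unique: "zig D u x v \<Longrightarrow> zig D u y v \<Longrightarrow> x = y"
  using good unfolding good_def by blast

definition normal :: "'a \<Rightarrow> bool" where
  "normal u \<longleftrightarrow> \<not> (\<exists>g\<in>S. lab g \<in> D \<and> s g = u)"

lemma pos_normal: "pos D u x v \<Longrightarrow> normal u \<Longrightarrow> v = u"
  by (cases rule: pos.cases) (auto simp: normal_def)

text \<open>Confluence joins \<open>u\<close> and \<open>v\<close>, and no step labelled in
  \<open>D\<close> leaves \<open>v\<close>, so the joining point is \<open>v\<close> itself. The
  directed path obtained has value \<open>x\<close> by uniqueness.\<close>

lemma zig_to_normal: 
  assumes "zig D u x v" "normal v"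
  shows "pos D u x v"
proof -
  obtain w a b where "pos D u a w" "pos D v b w" 
    using assms(1) good unfolding good_def by blast
  with assms show ?thesis using pos_normal pos_zig zig_unique by metis
qed

lemma zig_normal_eq: "zig D u x v \<Longrightarrow> normal u \<Longrightarrow> normal v \<Longrightarrow> u = v"
  using zig_to_normal pos_normal by metis

text \<open>In the local diagram of \<open>f\<close> with a step \<open>g\<close> labelled in
  \<open>D\<close>, the completions are labelled below \<alpha> and below \<open>lab g\<close>,
  hence in \<open>D\<close>. Solving for \<open>ev f\<close> expresses it as
  \<open>(ev g \<cdot> y) \<cdot> inv x\<close>.\<close>

lemma \<alpha>_step_not_normal:
  assumes "f \<in> S" "lab f = \<alpha>" "\<not> normal (s f)"
  shows "zig D (s f) (ev f) (t f)"
proof -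
  obtain g where g: "g \<in> S" "lab g \<in> D" "s g = s f"
    using assms(3) unfolding normal_def by blast
  obtain x y w where *: "pos {k. (k, lab f) \<in> r} (t f) x w" "pos {k. (k, lab g) \<in> r} (t g) y w"
    "ev f \<cdot> x = ev g \<cdot> y"
    using local[of f g] g assms by auto
  have x: "zig D (t f) x w" using *(1) \<alpha>(2) assms(2) by (auto intro!: pos_zig elim!: pos_mono)
  have y: "zig D (t g) y w" using *(2) down[OF g(2)] pos_mono pos_zig by blast
  have "ev f = (ev g \<cdot> y) \<cdot> inv x"
    using right_solve *(3) ev_hom[OF assms(1)] zig_hom[OF x] by metis
  then show ?thesis
    using zig_trans zig_step[OF g(1,2) y] zig_inv[OF x] g(3) by metis
qed

text \<open>Both completions of the local diagram are labelled below \<alpha>, hence in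
  \<open>D\<close>; \<open>c\<close> is the first followed by the inverse of the second.\<close>

lemma \<alpha>_steps_same_source:
  assumes "f \<in> S" "lab f = \<alpha>" "g \<in> S" "lab g = \<alpha>" "s f = s g"
  shows "\<exists>c. zig D (t f) c (t g) \<and> ev g = ev f \<cdot> c"
proof -
  obtain x y w where *: "pos {k. (k, lab f) \<in> r} (t f) x w" "pos {k. (k, lab g) \<in> r} (t g) y w"
    "ev f \<cdot> x = ev g \<cdot> y"
    using local[of f g] assms by auto
  have x: "zig D (t f) x w" using *(1) \<alpha>(2) assms by (auto intro!: pos_zig elim!: pos_mono)
  have y: "zig D (t g) y w" using *(2) \<alpha>(2) assms by (auto intro!: pos_zig elim!: pos_mono)
  have "ev g = (ev f \<cdot> x) \<cdot> inv y"
    using right_solve *(3) ev_hom[OF assms(3)] zig_hom[OF y] by metis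
  also have "\<dots> = ev f \<cdot> x \<cdot> inv y"
    using assoc[OF ev_hom[OF assms(1)] zig_hom[OF x] inv_hom[OF zig_hom[OF y]]] .
  finally show ?thesis using zig_trans[OF x zig_inv[OF y]] by blast
qed

text \<open>The other steps labelled \<alpha> have a source that is not normal and already are
  zigzags in \<open>D\<close>. Jumps are therefore the only edges left after contraction.\<close>

definition jump :: "'s \<Rightarrow> bool" where
  "jump f \<longleftrightarrow> f \<in> S \<and> lab f = \<alpha> \<and> normal (s f)"

text \<open>Contracting every \<open>D\<close>-component to a point leaves the graph of the jumps, in which every
  vertex has at most one outgoing edge.  The following relation describes its directed paths.\<close>

inductive jumps :: "nat \<Rightarrow> 'a \<Rightarrow> 'b \<Rightarrow> 'a \<Rightarrow> bool" where
  jumps_0: "zig D u x v \<Longrightarrow> jumps 0 u x v"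
| jumps_Suc: "zig D u a (s f) \<Longrightarrow> jump f \<Longrightarrow> jumps n (t f) y v \<Longrightarrow> jumps (Suc n) u (a \<cdot> ev f \<cdot> y) v"

inductive_cases jumps_0E: "jumps 0 u x v"
inductive_cases jumps_SucE: "jumps (Suc n) u x v"

lemma jump_hom: "jump f \<Longrightarrow> ev f \<in> hom (s f) (t f)"
  using ev_hom jump_def by blast

lemma jumps_hom: "jumps n u x v \<Longrightarrow> x \<in> hom u v"
  by (induction rule: jumps.induct) (auto intro: zig_hom jump_hom)

lemma jumps_pre: "jumps n u x v \<Longrightarrow> zig D u' a u \<Longrightarrow> jumps n u' (a \<cdot> x) v"
proof (induction rule: jumps.induct)
  case (jumps_0 u x v)
  then show ?case using jumps.jumps_0 zig_trans by blast
next
  case (jumps_Suc u b f n y v)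
  have "jumps (Suc n) u' ((a \<cdot> b) \<cdot> ev f \<cdot> y) v"
    using jumps_Suc zig_trans jumps.jumps_Suc by blast
  then show ?case
    using assoc zig_hom[OF jumps_Suc(1)] zig_hom[OF jumps_Suc(5)]
      comp_hom[OF jump_hom[OF jumps_Suc(2)] jumps_hom[OF jumps_Suc(3)]] by metis
qed

lemma jumps_trans: "jumps n u x v \<Longrightarrow> jumps m v y w \<Longrightarrow> jumps (n + m) u (x \<cdot> y) w"
proof (induction rule: jumps.induct)
  case (jumps_0 u x v)
  then show ?case using jumps_pre by simp
next
  case (jumps_Suc u a f n z v)
  have "jumps (Suc n + m) u (a \<cdot> ev f \<cdot> z \<cdot> y) w"
    using jumps_Suc jumps.jumps_Suc by simp
  moreover have "a \<cdot> ev f \<cdot> z \<cdot> y = (a \<cdot> ev f \<cdot> z) \<cdot> y"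
    using assoc3[OF zig_hom[OF jumps_Suc(1)] jump_hom[OF jumps_Suc(2)] jumps_hom[OF jumps_Suc(3)]
      jumps_hom[OF jumps_Suc(5)]] .
  ultimately show ?case by simp
qed

lemma jumps_1: "jump f \<Longrightarrow> jumps 1 (s f) (ev f) (t f)"
  using jumps_Suc[of "s f" "one (s f)" f 0 "one (t f)" "t f"] jumps_0 zig_one
    jump_hom[of f] hom_Obj[of "ev f" "s f" "t f"] one_left one_right by fastforce

lemma jumps_split:
  "jumps (n + m) u x w \<Longrightarrow> \<exists>v a b. jumps n u a v \<and> jumps m v b w \<and> x = a \<cdot> b"
proof (induction n arbitrary: u x)
  case 0
  then show ?case
    using jumps_hom[of m u x w] hom_Obj[of x u w] jumps_0 zig_one one_left by (metis add_0)
next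
  case (Suc n)
  then obtain a f y where *: "zig D u a (s f)" "jump f" "jumps (n + m) (t f) y w" "x = a \<cdot> ev f \<cdot> y"
    by (auto elim: jumps_SucE)
  then obtain v b c where **: "jumps n (t f) b v" "jumps m v c w" "y = b \<cdot> c" using Suc.IH by blast
  have "x = (a \<cdot> ev f \<cdot> b) \<cdot> c"
    using assoc3[OF zig_hom[OF *(1)] jump_hom[OF *(2)] jumps_hom[OF **(1)] jumps_hom[OF **(2)]]
      *(4) **(3) by simp
  then show ?case using * ** jumps_Suc by blast
qed

text \<open>The first jumps start at normal vertices of the component of \<open>u\<close>, hence at
  the same vertex, and two jumps from one vertex differ by a zigzag in \<open>D\<close>.\<close>

lemma jumps_deterministic:
  "jumps n u x v \<Longrightarrow> jumps n u y v' \<Longrightarrow> \<exists>c. zig D v c v' \<and> y = x \<cdot> c"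
proof (induction arbitrary: y rule: jumps.induct)
  case (jumps_0 u x v)
  then have "zig D u y v'" by (auto elim: jumps_0E)
  then show ?case
    using jumps_0(1) cancel_right zig_trans zig_inv zig_hom by metis
next
  case (jumps_Suc u a f n x v)
  obtain b g z where *: "zig D u b (s g)" "jump g" "jumps n (t g) z v'" "y = b \<cdot> ev g \<cdot> z"
    using jumps_Suc(5) by (auto elim: jumps_SucE)
  have eq: "s g = s f"
    using zig_normal_eq zig_trans[OF zig_inv[OF *(1)] jumps_Suc(1)] *(2) jumps_Suc(2) jump_def by blast
  then have "b = a" using *(1) jumps_Suc(1) zig_unique by metis
  obtain d where d: "zig D (t f) d (t g)" "ev g = ev f \<cdot> d"
    using \<alpha>_steps_same_source eq *(2) jumps_Suc(2) unfolding jump_def by metis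
  \<comment> \<open>The discrepancy \<open>d\<close> between the two jumps is absorbed into the rest
    of the second path, so that both remainders start at \<open>t f\<close>.\<close>
  obtain c where c: "zig D v c v'" "d \<cdot> z = x \<cdot> c"
    using jumps_Suc(4)[OF jumps_pre[OF *(3) d(1)]] by blast
  have f: "ev f \<in> hom (s f) (t f)" using jump_hom[OF jumps_Suc(2)] .
  have "y = a \<cdot> (ev f \<cdot> d) \<cdot> z" using * d \<open>b = a\<close> by simp
  also have "\<dots> = a \<cdot> ev f \<cdot> d \<cdot> z"
    using assoc[OF f zig_hom[OF d(1)] jumps_hom[OF *(3)]] by simp
  also have "\<dots> = a \<cdot> (ev f \<cdot> x) \<cdot> c"
    using assoc[OF f jumps_hom[OF jumps_Suc(3)] zig_hom[OF c(1)]] c(2) by simp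
  also have "\<dots> = (a \<cdot> ev f \<cdot> x) \<cdot> c"
    using assoc[OF zig_hom[OF jumps_Suc(1)] comp_hom[OF f jumps_hom[OF jumps_Suc(3)]] zig_hom[OF c(1)]]
    by simp
  finally show ?case using c(1) by blast
qed

text \<open>A zigzag in \<open>D\<close> that precedes a jump ends at a normal vertex, so
  \<open>zig_to_normal\<close> makes it directed. Only the zigzag after the last jump, collected in
  \<open>c\<close>, need not be directed.\<close>

lemma jumps_pos:
  "jumps n u x v \<Longrightarrow> \<exists>p v' c. pos (insert \<alpha> D) u p v' \<and> zig D v' c v \<and> x = p \<cdot> c"
proof (induction rule: jumps.induct)
  case (jumps_0 u x v)
  then show ?case using pos_one zig_hom hom_Obj one_left by metis
next
  case (jumps_Suc u a f n y v)
  then obtain p v' c where *: "pos (insert \<alpha> D) (t f) p v'" "zig D v' c v" "y = p \<cdot> c" by blast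
  have a: "pos (insert \<alpha> D) u a (s f)"
    using jumps_Suc(1,2) zig_to_normal pos_mono unfolding jump_def by blast
  have f: "pos (insert \<alpha> D) (s f) (ev f) (t f)"
    using jumps_Suc(2) pos_single unfolding jump_def by blast
  have "a \<cdot> ev f \<cdot> y = (a \<cdot> ev f \<cdot> p) \<cdot> c"
    using assoc3[OF pos_hom[OF a] pos_hom[OF f] pos_hom[OF *(1)] zig_hom[OF *(2)]] *(3) by simp
  then show ?case using pos_trans[OF a pos_trans[OF f *(1)]] *(2) by blast
qed

text \<open>A closed path of jumps is conjugate to one based at the source of a jump, which is
  \<open>D\<close>-normal; such a path is represented by a loop of steps.\<close>

lemma jumps_loop:
  assumes "jumps n u x u"
  shows "x = one u"
proof (cases n)
  case 0
  then show ?thesis using assms zig_unique zig_one zig_hom hom_Obj by (metis jumps_0E)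
next
  case (Suc m)
  then obtain a f y where *: "zig D u a (s f)" "jump f" "jumps m (t f) y u" "x = a \<cdot> ev f \<cdot> y"
    using assms by (auto elim: jumps_SucE)
  have "jumps (1 + m) (s f) (ev f \<cdot> y) u" using jumps_trans[OF jumps_1[OF *(2)] *(3)] .
  from jumps_trans[OF this jumps_0[OF *(1)]]
  obtain p v c where p: "pos (insert \<alpha> D) (s f) p v" "zig D v c (s f)" "(ev f \<cdot> y) \<cdot> a = p \<cdot> c"
    using jumps_pos by blast
  have "pos (insert \<alpha> D) v c (s f)"
    using p(2) *(2) zig_to_normal pos_mono unfolding jump_def by blast
  then have "p \<cdot> c = one (s f)" using loop pos_trans[OF p(1)] pos_mono by blast
  then show ?thesis
    using conjugate_one[OF zig_hom[OF *(1)] comp_hom[OF jump_hom[OF *(2)] jumps_hom[OF *(3)]]]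
      p(3) *(4) by simp
qed

lemma insert_step_cases:
  assumes "f \<in> S" "lab f \<in> insert \<alpha> D"
  obtains "zig D (s f) (ev f) (t f)" | "jump f"
  using assms zig_single \<alpha>_step_not_normal unfolding jump_def by blast

text \<open>When every vertex has at most one outgoing edge, the forward paths from two connected
  vertices meet. The equation says in addition that \<open>x\<close> is \<open>a\<close> followed by
  the inverse of \<open>b\<close>.\<close>

lemma zig_insert_jumps:
  "zig (insert \<alpha> D) u x v \<Longrightarrow> \<exists>n m w a b. jumps n u a w \<and> jumps m v b w \<and> x \<cdot> b = a"
proof (induction rule: zig.induct)
  case (zig_one u)
  then show ?case using jumps_0 zig.zig_one one_left one_hom by metis
next
  case (zig_step f x v)
  then obtain n m w a b where IH: "jumps n (t f) a w" "jumps m v b w" "x \<cdot> b = a" by blast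
  have "\<exists>n. jumps n (s f) (ev f \<cdot> a) w"
    using zig_step(1,2)
  proof (cases rule: insert_step_cases)
    case 1
    then show ?thesis using jumps_pre IH by blast
  next
    case 2
    then show ?thesis using jumps_trans[OF jumps_1] IH by blast
  qed
  moreover have "(ev f \<cdot> x) \<cdot> b = ev f \<cdot> a"
    using assoc[OF ev_hom[OF zig_step(1)] zig_hom[OF zig_step(3)] jumps_hom[OF IH(2)]] IH(3) by simp
  ultimately show ?case using IH(2) by blast
next
  case (zig_back f x v)
  then obtain n m w a b where IH: "jumps n (s f) a w" "jumps m v b w" "x \<cdot> b = a" by blast
  have f: "ev f \<in> hom (s f) (t f)" using zig_back(1) ev_hom by blast
  have x: "x \<in> hom (s f) v" using zig_hom zig_back(3) by blast
  have eq: "(inv (ev f) \<cdot> x) \<cdot> b' = inv (ev f) \<cdot> x \<cdot> b'" if "b' \<in> hom v w'" for b' w'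
    using assoc[OF inv_hom[OF f] x that] .
  from zig_back(1,2) show ?case
  proof (cases rule: insert_step_cases)
    case 1
    then have "jumps n (t f) (inv (ev f) \<cdot> a) w" using IH(1) jumps_pre zig_inv by blast
    then show ?thesis using IH(2,3) eq[OF jumps_hom[OF IH(2)]] by metis
  next
    case 2
    show ?thesis
    proof (cases n)
      \<comment> \<open>Here \<open>w\<close> lies in the component of \<open>s f\<close>, so the
        path from \<open>v\<close> can be prolonged along \<open>f\<close>. The meeting point
        becomes \<open>t f\<close>, reached from \<open>t f\<close> by the trivial path.\<close>
      case 0
      then have a: "zig D (s f) a w" using IH(1) by (auto elim: jumps_0E)
      have "jumps 1 w (inv a \<cdot> ev f) (t f)" using jumps_pre[OF jumps_1[OF 2] zig_inv[OF a]] .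
      then have b': "jumps (m + 1) v (b \<cdot> inv a \<cdot> ev f) (t f)" using jumps_trans IH(2) by blast
      have "x \<cdot> b \<cdot> inv a \<cdot> ev f = (x \<cdot> b) \<cdot> inv a \<cdot> ev f"
        using assoc[OF x jumps_hom[OF IH(2)] comp_hom[OF inv_hom[OF zig_hom[OF a]] f]] by simp
      also have "\<dots> = ev f" using IH(3) cancel_right[OF zig_hom[OF a] f] by simp
      finally have "(inv (ev f) \<cdot> x) \<cdot> b \<cdot> inv a \<cdot> ev f = one (t f)"
        using eq[OF jumps_hom[OF b']] inv_left[OF f] by simp
      moreover have "jumps 0 (t f) (one (t f)) (t f)"
        using jumps_0 zig_one f hom_Obj by blast
      ultimately show ?thesis using b' by blast
    next
      \<comment> \<open>By determinism the first jump of \<open>a\<close> is \<open>f\<close> up to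
        a zigzag in \<open>D\<close>, so \<open>f\<close> cancels and one jump is dropped.\<close>
      case (Suc n')
      then have "jumps (1 + n') (s f) a w" using IH(1) by simp
      then obtain v' p q where pq: "jumps 1 (s f) p v'" "jumps n' v' q w" "a = p \<cdot> q"
        using jumps_split by blast
      then obtain c where c: "zig D (t f) c v'" "p = ev f \<cdot> c"
        using jumps_deterministic jumps_1[OF 2] by blast
      have "jumps n' (t f) (c \<cdot> q) w" using jumps_pre[OF pq(2) c(1)] .
      moreover have "a = ev f \<cdot> c \<cdot> q"
        using pq(3) c(2) assoc[OF f zig_hom[OF c(1)] jumps_hom[OF pq(2)]] by simp
      ultimately show ?thesis
        using cancel_left[OF f] eq[OF jumps_hom[OF IH(2)]] IH(2,3) jumps_hom by metis
    qed
  qed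
qed

text \<open>By determinism the first \<open>n\<close> jumps of the longer path agree with the
  shorter one up to a zigzag in \<open>D\<close>. What remains is a closed path at \<open>w\<close>,
  trivial by \<open>jumps_loop\<close>.\<close>

lemma jumps_parallel_le:
  assumes "jumps n u a w" "jumps m u b w" "n \<le> m"
  shows "a = b"
proof -
  obtain k where "m = n + k" using assms(3) le_Suc_ex by blast
  then obtain v p q where pq: "jumps n u p v" "jumps k v q w" "b = p \<cdot> q"
    using assms(2) jumps_split by blast
  obtain c where c: "zig D w c v" "p = a \<cdot> c"
    using jumps_deterministic[OF assms(1) pq(1)] by blast
  have "c \<cdot> q = one w" using jumps_loop[OF jumps_pre[OF pq(2) c(1)]] .
  moreover have "b = a \<cdot> c \<cdot> q"
    using assoc[OF jumps_hom[OF assms(1)] zig_hom[OF c(1)] jumps_hom[OF pq(2)]] pq(3) c(2) by simp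
  ultimately show ?thesis using one_right[OF jumps_hom[OF assms(1)]] by simp
qed

text \<open>For a closed zigzag the two meeting paths of jumps are parallel, hence equal in value,
  and cancel.\<close>

lemma zig_insert_loop:
  assumes "zig (insert \<alpha> D) u x u"
  shows "x = one u"
proof -
  obtain n m w a b where *: "jumps n u a w" "jumps m u b w" "x \<cdot> b = a"
    using zig_insert_jumps[OF assms] by blast
  then have "a = b" using jumps_parallel_le by (metis nat_le_linear)
  then show ?thesis using * right_fixed_one zig_hom[OF assms] jumps_hom by blast
qed

lemma good_insert: "good (insert \<alpha> D)"
  unfolding good_def
proof (intro conjI allI impI)
  fix k l assume "l \<in> insert \<alpha> D" "(k, l) \<in> r"
  then show "k \<in> insert \<alpha> D" using down \<alpha>(2) by blast
next
  fix u x y v assume x: "zig (insert \<alpha> D) u x v" and y: "zig (insert \<alpha> D) u y v"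
  have "x \<cdot> inv y = one u" using zig_insert_loop zig_trans[OF x zig_inv[OF y]] by blast
  then show "x = y"
    using right_solve[OF zig_hom[OF x] inv_hom[OF zig_hom[OF y]]] inv_inv one_left zig_hom[OF y]
    by metis
next
  fix u x v assume "zig (insert \<alpha> D) u x v"
  then obtain n m w a b where *: "jumps n u a w" "jumps m v b w"
    using zig_insert_jumps by blast
  obtain p v1 c where p: "pos (insert \<alpha> D) u p v1" "zig D v1 c w" using jumps_pos[OF *(1)] by blast
  obtain q v2 d where q: "pos (insert \<alpha> D) v q v2" "zig D v2 d w" using jumps_pos[OF *(2)] by blast
  \<comment> \<open>The ends \<open>v1\<close> and \<open>v2\<close> of the directed parts still
    differ by a zigzag in \<open>D\<close>, and confluence of \<open>D\<close> joins them.\<close>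
  obtain w' a' b' where "pos D v1 a' w'" "pos D v2 b' w'"
    using zig_trans[OF p(2) zig_inv[OF q(2)]] good unfolding good_def by blast
  then have "pos (insert \<alpha> D) v1 a' w'" "pos (insert \<alpha> D) v2 b' w'"
    using pos_mono subset_insertI by metis+
  then show "\<exists>w a b. pos (insert \<alpha> D) u a w \<and> pos (insert \<alpha> D) v b w"
    using p(1) q(1) pos_trans by blast
qed

end

text \<open>Unions of chains of good sets are good, so Zorn's lemma gives a maximal one. If it
  missed a label, well-foundedness of \<open>r\<close> would give a minimal missing label, and
  \<open>good_insert\<close> would add it.\<close>

theorem zig_parallel:
  assumes local: "\<And>f g. f \<in> S \<Longrightarrow> g \<in> S \<Longrightarrow> s f = s g \<Longrightarrow>
      \<exists>x y w. pos {k. (k, lab f) \<in> r} (t f) x w \<and> pos {k. (k, lab g) \<in> r} (t g) y w \<and>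
        ev f \<cdot> x = ev g \<cdot> y"
    and loop: "\<And>u x. pos UNIV u x u \<Longrightarrow> x = one u"
    and "zig UNIV u x v" "zig UNIV u y v"
  shows "x = y"
proof -
  have "\<exists>M\<in>Collect good. \<forall>X\<in>Collect good. M \<subseteq> X \<longrightarrow> X = M"
  proof (rule subset_Zorn_nonempty)
    show "Collect good \<noteq> {}" using good_empty by blast
  next
    fix C assume "C \<noteq> {}" "subset.chain (Collect good) C"
    then show "\<Union>C \<in> Collect good"
      using good_Union[of C] by (auto simp: subset_chain_def)
  qed
  then obtain M where M: "good M" "\<And>X. good X \<Longrightarrow> M \<subseteq> X \<Longrightarrow> X = M" by blast
  have "M = UNIV"
  proof (rule ccontr)
    assume "M \<noteq> UNIV"
    then obtain \<alpha> where "\<alpha> \<notin> M" "\<And>k. (k, \<alpha>) \<in> r \<Longrightarrow> k \<in> M"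
      using wf_r by (metis UNIV_eq_I wfE_min ComplI Compl_iff)
    then have "good (insert \<alpha> M)" using good_insert[OF M(1)] local loop by blast
    then show False using M(2) \<open>\<alpha> \<notin> M\<close> by blast
  qed
  then show ?thesis using M(1) assms(3,4) unfolding good_def by blast
qed

end


section \<open>Calculus of 1-cells and 2-cells\<close>

lemma src0_comp1 [simp]: "src0 (comp1 p q) = src0 p"
  and tgt0_comp1 [simp]: "tgt0 (comp1 p q) = tgt0 q"
  and src0_ident0 [simp]: "src0 (ident0 x) = x"
  and tgt0_ident0 [simp]: "tgt0 (ident0 x) = x"
  by (simp_all add: src0_def tgt0_def comp1_def ident0_def)

lemma comp1_assoc: "comp1 (comp1 p q) w = comp1 p (comp1 q w)"
  by (simp add: src0_def tgt0_def comp1_def)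

lemma comp1_ident0 [simp]: "comp1 (ident0 (src0 p)) p = p" "comp1 p (ident0 (tgt0 p)) = p"
  by (simp_all add: src0_def tgt0_def comp1_def ident0_def)

lemma fst_snd_comp1 [simp]: "fst (snd (comp1 p q)) = fst (snd p) @ fst (snd q)"
  by (simp add: comp1_def)

lemma mem_cells1: "p \<in> cells1 P \<longleftrightarrow> pre_digraph.awalk (graph P) (src0 p) (fst (snd p)) (tgt0 p)"
  by (cases p) (simp add: cells1_def src0_def tgt0_def)

locale polygraph =
  fixes P :: "('v, 'e, 'a) polygraph2"
  assumes polygraph: "two_polygraph P"
begin

sublocale wf_digraph "graph P"
  using polygraph unfolding two_polygraph_def by blast

lemma comp1_cells1 [intro]:
  "p \<in> cells1 P \<Longrightarrow> q \<in> cells1 P \<Longrightarrow> tgt0 p = src0 q \<Longrightarrow> comp1 p q \<in> cells1 P"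
  unfolding mem_cells1 using awalk_appendI by auto

lemma ident0_cells1 [intro]:
  assumes "p \<in> cells1 P"
  shows "ident0 (src0 p) \<in> cells1 P" "ident0 (tgt0 p) \<in> cells1 P"
  using assms awalk_hd_in_verts awalk_last_in_verts unfolding mem_cells1
  by (auto simp: ident0_def src0_def tgt0_def awalk_Nil_iff)

lemma cells1_Nil:
  assumes "p \<in> cells1 P" "fst (snd p) = []"
  shows "p = ident0 (src0 p)" "p = ident0 (tgt0 p)"
  using assms by (auto simp: mem_cells1 ident0_def src0_def tgt0_def awalk_Nil_iff prod_eq_iff)

section \<open>Boundaries and operations of 2-cells\<close>

lemma wf2_boundary:
  "wf2 P b f \<Longrightarrow> esrc1 P f \<in> cells1 P \<and> etgt1 P f \<in> cells1 P \<and>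
    src0 (etgt1 P f) = src0 (esrc1 P f) \<and> tgt0 (etgt1 P f) = tgt0 (esrc1 P f)"
proof (induction f)
  case (Gen \<alpha>)
  then show ?case using polygraph unfolding two_polygraph_def by auto
qed auto

text \<open>Checked axiom by axiom; it lets \<open>src1\<close> and \<open>tgt1\<close> be computed
  from any representative.\<close>

lemma eq2_boundary:
  "eq2 P b f g \<Longrightarrow> wf2 P b f \<and> wf2 P b g \<and> esrc1 P f = esrc1 P g \<and> etgt1 P f = etgt1 P g"
proof (induction rule: eq2.induct)
  case (unitl_HC f)
  then show ?case using wf2_boundary[of b f] comp1_ident0(1)[of "etgt1 P f"] by auto
next
  case (unitr_HC f)
  then show ?case using wf2_boundary[of b f] comp1_ident0(2)[of "etgt1 P f"] by auto
next
  case (exchange f g h k)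
  then show ?case using wf2_boundary[of b f] wf2_boundary[of b h] by auto
qed (auto simp: comp1_assoc dest: wf2_boundary)

lemma mem_cls2: "wf2 P b f \<Longrightarrow> f \<in> cls2 P b f"
  unfolding cls2_def by (simp add: eq2.refl)

lemma cls2_eq: "eq2 P b f g \<Longrightarrow> cls2 P b f = cls2 P b g"
  unfolding cls2_def using eq2.sym eq2.trans by blast

lemma cls2_cells2 [simp]: "wf2 P b f \<Longrightarrow> cls2 P b f \<in> cells2 P b"
  unfolding cells2_def by blast

lemma cells2E:
  assumes "F \<in> cells2 P b"
  obtains f where "wf2 P b f" "F = cls2 P b f"
  using assms unfolding cells2_def by blast

lemma src1_cls2 [simp]: "wf2 P b f \<Longrightarrow> src1 P (cls2 P b f) = esrc1 P f"
proof -
  assume "wf2 P b f"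
  then have "esrc1 P ` cls2 P b f = {esrc1 P f}"
    using eq2_boundary mem_cls2 unfolding cls2_def by fastforce
  then show ?thesis unfolding src1_def by simp
qed

lemma tgt1_cls2 [simp]: "wf2 P b f \<Longrightarrow> tgt1 P (cls2 P b f) = etgt1 P f"
proof -
  assume "wf2 P b f"
  then have "etgt1 P ` cls2 P b f = {etgt1 P f}"
    using eq2_boundary mem_cls2 unfolding cls2_def by fastforce
  then show ?thesis unfolding tgt1_def by simp
qed

text \<open>Congruence makes the class of the composite independent of the representatives, so all
  members of the union in \<open>hcomp\<close> coincide. The laws for 2-cells thereby reduce to the
  axioms on expressions.\<close>

lemma hcomp_cls2 [simp]:
  assumes "wf2 P b (HC f g)"
  shows "hcomp P b (cls2 P b f) (cls2 P b g) = cls2 P b (HC f g)"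
proof -
  have "cls2 P b (HC f' g') = cls2 P b (HC f g)" if "f' \<in> cls2 P b f" "g' \<in> cls2 P b g" for f' g'
    using that cls2_eq[OF eq2.cong_HC] assms unfolding cls2_def by blast
  moreover have "f \<in> cls2 P b f" "g \<in> cls2 P b g" using assms mem_cls2 by auto
  ultimately show ?thesis unfolding hcomp_def by blast
qed

lemma vcomp_cls2 [simp]:
  assumes "wf2 P b (VC f g)"
  shows "vcomp P b (cls2 P b f) (cls2 P b g) = cls2 P b (VC f g)"
proof -
  have "cls2 P b (VC f' g') = cls2 P b (VC f g)" if "f' \<in> cls2 P b f" "g' \<in> cls2 P b g" for f' g'
    using that cls2_eq[OF eq2.cong_VC] assms unfolding cls2_def by blast
  moreover have "f \<in> cls2 P b f" "g \<in> cls2 P b g" using assms mem_cls2 by auto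
  ultimately show ?thesis unfolding vcomp_def by blast
qed

lemma inv2_cls2 [simp]:
  assumes "wf2 P True f"
  shows "inv2 P (cls2 P True f) = cls2 P True (Inv f)"
proof -
  have "cls2 P True (Inv f') = cls2 P True (Inv f)" if "f' \<in> cls2 P True f" for f'
    using that cls2_eq[OF eq2.cong_Inv] assms unfolding cls2_def by auto
  then show ?thesis using mem_cls2[OF assms] unfolding inv2_def by blast
qed

lemma wf2_True: "wf2 P False f \<Longrightarrow> wf2 P True f"
  by (induction f) auto

lemma eq2_True: "eq2 P False f g \<Longrightarrow> eq2 P True f g"
  by (induction rule: eq2.induct) ((rule eq2.intros, (assumption | erule wf2_True)+)[1])+

lemma incl2_cls2 [simp]:
  assumes "wf2 P False f"
  shows "incl2 P (cls2 P False f) = cls2 P True f"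
proof -
  have "cls2 P True f' = cls2 P True f" if "f' \<in> cls2 P False f" for f'
    using that cls2_eq[OF eq2_True] unfolding cls2_def by auto
  then show ?thesis using mem_cls2[OF assms] unfolding incl2_def by blast
qed

lemma boundary_cells1 [simp]:
  assumes "F \<in> cells2 P b"
  shows "src1 P F \<in> cells1 P" "tgt1 P F \<in> cells1 P"
  using assms wf2_boundary by (auto elim!: cells2E)

lemma boundary_tgt1 [simp]:
  assumes "F \<in> cells2 P b"
  shows "src0 (tgt1 P F) = src0 (src1 P F)" "tgt0 (tgt1 P F) = tgt0 (src1 P F)"
  using assms wf2_boundary by (auto elim!: cells2E)

text \<open>The simplifier does not find a value for \<open>b\<close>, which occurs only in the premises.\<close>

lemmas [simp] =
  boundary_cells1[where b = True] boundary_cells1[where b = False]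
  boundary_tgt1[where b = True] boundary_tgt1[where b = False]

lemma hcomp_cells2 [simp]:
  assumes "F \<in> cells2 P b" "G \<in> cells2 P b" "tgt0 (src1 P F) = src0 (src1 P G)"
  shows "hcomp P b F G \<in> cells2 P b"
    and "src1 P (hcomp P b F G) = comp1 (src1 P F) (src1 P G)"
    and "tgt1 P (hcomp P b F G) = comp1 (tgt1 P F) (tgt1 P G)"
  using assms by (auto elim!: cells2E)

lemma vcomp_cells2 [simp]:
  assumes "F \<in> cells2 P b" "G \<in> cells2 P b" "tgt1 P F = src1 P G"
  shows "vcomp P b F G \<in> cells2 P b"
    and "src1 P (vcomp P b F G) = src1 P F"
    and "tgt1 P (vcomp P b F G) = tgt1 P G"
  using assms by (auto elim!: cells2E)

lemma ident1_cells2 [simp]: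
  assumes "p \<in> cells1 P"
  shows "ident1 P b p \<in> cells2 P b" "src1 P (ident1 P b p) = p" "tgt1 P (ident1 P b p) = p"
  using assms unfolding ident1_def by auto

lemma inv2_cells2 [simp]:
  assumes "F \<in> cells2 P True"
  shows "inv2 P F \<in> cells2 P True" "src1 P (inv2 P F) = tgt1 P F" "tgt1 P (inv2 P F) = src1 P F"
  using assms by (auto elim!: cells2E)

lemma incl2_cells2 [simp]:
  assumes "F \<in> cells2 P False"
  shows "incl2 P F \<in> cells2 P True" "src1 P (incl2 P F) = src1 P F" "tgt1 P (incl2 P F) = tgt1 P F"
  using assms wf2_True by (auto elim!: cells2E)

lemma hcomp_assoc:
  assumes "F \<in> cells2 P b" "G \<in> cells2 P b" "H \<in> cells2 P b"
    "tgt0 (src1 P F) = src0 (src1 P G)" "tgt0 (src1 P G) = src0 (src1 P H)"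
  shows "hcomp P b (hcomp P b F G) H = hcomp P b F (hcomp P b G H)"
  using assms by (auto elim!: cells2E simp: cls2_eq[OF eq2.assoc_HC])

lemma vcomp_assoc:
  assumes "F \<in> cells2 P b" "G \<in> cells2 P b" "H \<in> cells2 P b"
    "tgt1 P F = src1 P G" "tgt1 P G = src1 P H"
  shows "vcomp P b (vcomp P b F G) H = vcomp P b F (vcomp P b G H)"
  using assms by (auto elim!: cells2E simp: cls2_eq[OF eq2.assoc_VC])

lemma hcomp_ident [simp]:
  assumes "F \<in> cells2 P b"
  shows "hcomp P b (ident1 P b (ident0 (src0 (src1 P F)))) F = F"
    and "hcomp P b F (ident1 P b (ident0 (tgt0 (src1 P F)))) = F"
  using assms unfolding ident1_def
  by (auto elim!: cells2E simp: wf2_boundary ident0_cells1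
      cls2_eq[OF eq2.unitl_HC] cls2_eq[OF eq2.unitr_HC])

lemma vcomp_ident [simp]:
  assumes "F \<in> cells2 P b"
  shows "vcomp P b (ident1 P b (src1 P F)) F = F"
    and "vcomp P b F (ident1 P b (tgt1 P F)) = F"
  using assms unfolding ident1_def
  by (auto elim!: cells2E simp: wf2_boundary cls2_eq[OF eq2.unitl_VC] cls2_eq[OF eq2.unitr_VC])

lemma hcomp_ident1 [simp]:
  "p \<in> cells1 P \<Longrightarrow> q \<in> cells1 P \<Longrightarrow> tgt0 p = src0 q \<Longrightarrow>
    hcomp P b (ident1 P b p) (ident1 P b q) = ident1 P b (comp1 p q)"
  unfolding ident1_def by (simp add: cls2_eq[OF eq2.id_HC])

lemma vcomp_ident1 [simp]:
  "p \<in> cells1 P \<Longrightarrow> vcomp P b (ident1 P b p) (ident1 P b p) = ident1 P b p"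
  using vcomp_ident(1)[of "ident1 P b p"] by simp

lemma hcomp_vcomp:
  assumes "F \<in> cells2 P b" "G \<in> cells2 P b" "H \<in> cells2 P b" "K \<in> cells2 P b"
    "tgt1 P F = src1 P G" "tgt1 P H = src1 P K" "tgt0 (src1 P F) = src0 (src1 P H)"
  shows "hcomp P b (vcomp P b F G) (vcomp P b H K) = vcomp P b (hcomp P b F H) (hcomp P b G K)"
proof -
  obtain f g h k where *: "wf2 P b f" "F = cls2 P b f" "wf2 P b g" "G = cls2 P b g"
    "wf2 P b h" "H = cls2 P b h" "wf2 P b k" "K = cls2 P b k"
    using assms(1-4) by (metis cells2E)
  then have "wf2 P b (HC (VC f g) (VC h k))" "wf2 P b (VC (HC f h) (HC g k))"
    using assms wf2_boundary[of b f] wf2_boundary[of b h] by auto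
  then show ?thesis using * cls2_eq[OF eq2.exchange] by auto
qed

lemma vcomp_inv2 [simp]:
  assumes "F \<in> cells2 P True"
  shows "vcomp P True F (inv2 P F) = ident1 P True (src1 P F)"
    and "vcomp P True (inv2 P F) F = ident1 P True (tgt1 P F)"
  using assms unfolding ident1_def by (auto elim!: cells2E simp: cls2_eq[OF eq2.invr] cls2_eq[OF eq2.invl])

text \<open>Cancelling \<open>F\<close> on the left of the given equation leaves \<open>G\<close>.
  The lemma identifies the inverse of a whiskered cell.\<close>

lemma inv2_unique:
  assumes "F \<in> cells2 P True" "G \<in> cells2 P True" "tgt1 P F = src1 P G"
    "vcomp P True F G = ident1 P True (src1 P F)"
  shows "G = inv2 P F"
proof -
  have "inv2 P F = vcomp P True (inv2 P F) (vcomp P True F G)"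
    using assms(1,4) vcomp_ident(2)[of "inv2 P F" True] by simp
  also have "\<dots> = vcomp P True (ident1 P True (src1 P G)) G"
    using assms(1-3) vcomp_assoc[of "inv2 P F" True F G] by simp
  also have "\<dots> = G"
    using assms(2) by simp
  finally show ?thesis ..
qed

lemma incl2_ident1 [simp]: "p \<in> cells1 P \<Longrightarrow> incl2 P (ident1 P False p) = ident1 P True p"
  unfolding ident1_def by simp

lemma incl2_hcomp:
  assumes "F \<in> cells2 P False" "G \<in> cells2 P False" "tgt0 (src1 P F) = src0 (src1 P G)"
  shows "incl2 P (hcomp P False F G) = hcomp P True (incl2 P F) (incl2 P G)"
  using assms wf2_True by (auto elim!: cells2E)

lemma incl2_vcomp:
  assumes "F \<in> cells2 P False" "G \<in> cells2 P False" "tgt1 P F = src1 P G"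
  shows "incl2 P (vcomp P False F G) = vcomp P True (incl2 P F) (incl2 P G)"
  using assms wf2_True by (auto elim!: cells2E)

section \<open>Whiskering by 1-cells\<close>

lemma composable_ctxD:
  "composable_ctx P u F v \<Longrightarrow>
    u \<in> cells1 P \<and> v \<in> cells1 P \<and> tgt0 u = src0 (src1 P F) \<and> tgt0 (src1 P F) = src0 v"
  unfolding composable_ctx_def by blast

lemma whisker_cells2:
  assumes "F \<in> cells2 P b" "composable_ctx P u F v"
  shows "whisker P b u F v \<in> cells2 P b"
    and "src1 P (whisker P b u F v) = comp1 (comp1 u (src1 P F)) v"
    and "tgt1 P (whisker P b u F v) = comp1 (comp1 u (tgt1 P F)) v"
  using assms composable_ctxD[OF assms(2)] unfolding whisker_def by auto

lemma whisker_vcomp: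
  assumes "F \<in> cells2 P b" "G \<in> cells2 P b" "tgt1 P F = src1 P G" "composable_ctx P u F v"
  shows "whisker P b u (vcomp P b F G) v = vcomp P b (whisker P b u F v) (whisker P b u G v)"
proof -
  have *: "u \<in> cells1 P" "v \<in> cells1 P" "tgt0 u = src0 (src1 P F)" "tgt0 (src1 P F) = src0 v"
    using composable_ctxD[OF assms(4)] by auto
  have G: "src0 (src1 P G) = src0 (src1 P F)" "tgt0 (src1 P G) = tgt0 (src1 P F)"
    using boundary_tgt1[OF assms(1)] assms(3) by auto
  have "hcomp P b (ident1 P b u) (vcomp P b F G)
      = vcomp P b (hcomp P b (ident1 P b u) F) (hcomp P b (ident1 P b u) G)"
    using hcomp_vcomp[of "ident1 P b u" b "ident1 P b u" F G] assms * G by simp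
  then show ?thesis
    using hcomp_vcomp[of "hcomp P b (ident1 P b u) F" b "hcomp P b (ident1 P b u) G"
        "ident1 P b v" "ident1 P b v"] assms * G
    unfolding whisker_def by simp
qed

lemma whisker_ident1:
  assumes "p \<in> cells1 P" "u \<in> cells1 P" "v \<in> cells1 P" "tgt0 u = src0 p" "tgt0 p = src0 v"
  shows "whisker P b u (ident1 P b p) v = ident1 P b (comp1 (comp1 u p) v)"
  using assms unfolding whisker_def by (simp add: comp1_cells1)

text \<open>Associativity moves the outer 1-cells next to the inner ones. It follows that steps are
  closed under contexts.\<close>

lemma whisker_whisker:
  assumes "F \<in> cells2 P b" "composable_ctx P u F v" "composable_ctx P u' (whisker P b u F v) v'"
  shows "whisker P b u' (whisker P b u F v) v' = whisker P b (comp1 u' u) F (comp1 v v')"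
proof -
  have *: "u \<in> cells1 P" "v \<in> cells1 P" "tgt0 u = src0 (src1 P F)" "tgt0 (src1 P F) = src0 v"
    "u' \<in> cells1 P" "v' \<in> cells1 P" "tgt0 u' = src0 u" "tgt0 v = src0 v'"
    using composable_ctxD[OF assms(2)] composable_ctxD[OF assms(3)] whisker_cells2[OF assms(1,2)]
    by auto
  have "hcomp P b (ident1 P b u') (hcomp P b (hcomp P b (ident1 P b u) F) (ident1 P b v))
     = hcomp P b (hcomp P b (ident1 P b u') (hcomp P b (ident1 P b u) F)) (ident1 P b v)"
    using assms(1) * hcomp_assoc[of "ident1 P b u'" b "hcomp P b (ident1 P b u) F" "ident1 P b v"]
    by simp
  also have "hcomp P b (ident1 P b u') (hcomp P b (ident1 P b u) F) =
      hcomp P b (ident1 P b (comp1 u' u)) F"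
    using assms(1) * hcomp_assoc[of "ident1 P b u'" b "ident1 P b u" F] by simp
  finally show ?thesis
    unfolding whisker_def
    using assms(1) * hcomp_assoc[of "hcomp P b (ident1 P b (comp1 u' u)) F" b "ident1 P b v" "ident1 P b v'"]
    by (simp add: comp1_cells1)
qed

lemma whisker_ident0:
  assumes "F \<in> cells2 P b"
  shows "whisker P b (ident0 (src0 (src1 P F))) F (ident0 (tgt0 (src1 P F))) = F"
  using assms unfolding whisker_def by simp

lemma incl2_whisker:
  assumes "F \<in> cells2 P False" "composable_ctx P u F v"
  shows "incl2 P (whisker P False u F v) = whisker P True u (incl2 P F) v"
  using assms composable_ctxD[OF assms(2)] unfolding whisker_def by (simp add: incl2_hcomp)

lemma composable_ctx_cong:
  "composable_ctx P u F v \<Longrightarrow> src0 (src1 P G) = src0 (src1 P F) \<Longrightarrow> tgt0 (src1 P G) = tgt0 (src1 P F)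
    \<Longrightarrow> composable_ctx P u G v"
  unfolding composable_ctx_def by auto

lemma whisker_inv2:
  assumes "F \<in> cells2 P True" "composable_ctx P u F v"
  shows "whisker P True u (inv2 P F) v = inv2 P (whisker P True u F v)"
proof (rule inv2_unique)
  have ctx: "composable_ctx P u (inv2 P F) v"
    using composable_ctx_cong[OF assms(2)] assms(1) by simp
  show "whisker P True u F v \<in> cells2 P True" "whisker P True u (inv2 P F) v \<in> cells2 P True"
    "tgt1 P (whisker P True u F v) = src1 P (whisker P True u (inv2 P F) v)"
    using whisker_cells2[OF assms] whisker_cells2[OF _ ctx] assms(1) by simp_all
  show "vcomp P True (whisker P True u F v) (whisker P True u (inv2 P F) v)
      = ident1 P True (src1 P (whisker P True u F v))"
    using whisker_vcomp[of F True "inv2 P F" u v] assms whisker_ident1[of "src1 P F" u v True]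
      composable_ctxD[OF assms(2)] whisker_cells2[OF assms] by simp
qed

section \<open>Rewriting steps and rewriting sequences\<close>

lemma gen2_cells2:
  assumes "\<alpha> \<in> gens2 P"
  shows "gen2 P b \<alpha> \<in> cells2 P b" "src1 P (gen2 P b \<alpha>) = gsrc1 P \<alpha>" "tgt1 P (gen2 P b \<alpha>) = gtgt1 P \<alpha>"
  using assms unfolding gen2_def by auto

lemma steps_cells2: "F \<in> steps P \<Longrightarrow> F \<in> cells2 P False"
  unfolding steps_def using whisker_cells2 gen2_cells2 by blast

lemma whisker_steps:
  assumes "F \<in> steps P" "composable_ctx P u F v"
  shows "whisker P False u F v \<in> steps P"
proof -
  obtain u' \<alpha> v' where *: "\<alpha> \<in> gens2 P" "composable_ctx P u' (gen2 P False \<alpha>) v'"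
    "F = whisker P False u' (gen2 P False \<alpha>) v'"
    using assms(1) unfolding steps_def by blast
  have g: "gen2 P False \<alpha> \<in> cells2 P False" using gen2_cells2 *(1) by blast
  have "composable_ctx P (comp1 u u') (gen2 P False \<alpha>) (comp1 v' v)"
    using composable_ctxD[OF *(2)] composable_ctxD[OF assms(2)] whisker_cells2[OF g *(2)] *(3)
    unfolding composable_ctx_def by auto
  moreover have "whisker P False u F v
      = whisker P False (comp1 u u') (gen2 P False \<alpha>) (comp1 v' v)"
    using whisker_whisker[OF g *(2)] assms(2) *(3) by blast
  ultimately show ?thesis using *(1) unfolding steps_def by blast
qed

lemma gen2_steps:
  assumes "\<alpha> \<in> gens2 P"
  shows "gen2 P False \<alpha> \<in> steps P"
proof -
  let ?g = "gen2 P False \<alpha>"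
  have g: "?g \<in> cells2 P False" using gen2_cells2 assms by blast
  have "composable_ctx P (ident0 (src0 (src1 P ?g))) ?g (ident0 (tgt0 (src1 P ?g)))"
    using g ident0_cells1 unfolding composable_ctx_def by simp
  then show ?thesis using whisker_ident0[OF g] assms unfolding steps_def by blast
qed

lemma seq_cell_cells2:
  assumes "rseq P p Fs q"
  shows "seq_cell P p Fs \<in> cells2 P False \<and> src1 P (seq_cell P p Fs) = p \<and> tgt1 P (seq_cell P p Fs) = q"
  using assms
proof (induction Fs arbitrary: p)
  case (Cons F Fs)
  then show ?case using Cons.IH[of "tgt1 P F"] steps_cells2[of F] by simp
qed simp

lemma seq_cell_append:
  assumes "rseq P p Fs q" "rseq P q Gs w"
  shows "seq_cell P p (Fs @ Gs) = vcomp P False (seq_cell P p Fs) (seq_cell P q Gs)"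
  using assms
proof (induction Fs arbitrary: p)
  case Nil
  then show ?case using seq_cell_cells2[OF Nil(2)] by (metis append_Nil rseq.simps(1) seq_cell.simps(1) vcomp_ident(1))
next
  case (Cons F Fs)
  then have "rseq P (tgt1 P F) Fs q" by simp
  then show ?case
    using Cons.prems Cons.IH[of "tgt1 P F"] seq_cell_cells2[of "tgt1 P F" Fs q]
      seq_cell_cells2[OF Cons(3)] steps_cells2[of F] by (simp add: vcomp_assoc)
qed

lemma whisker_rseq:
  assumes "rseq P p Fs q" "u \<in> cells1 P" "v \<in> cells1 P" "tgt0 u = src0 p" "tgt0 p = src0 v"
  shows "rseq P (comp1 (comp1 u p) v) (map (\<lambda>F. whisker P False u F v) Fs) (comp1 (comp1 u q) v) \<and>
    seq_cell P (comp1 (comp1 u p) v) (map (\<lambda>F. whisker P False u F v) Fs)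
      = whisker P False u (seq_cell P p Fs) v"
  using assms(1,4,5)
proof (induction Fs arbitrary: p)
  case Nil
  then show ?case using assms(2,3) by (auto simp: whisker_ident1 intro!: comp1_cells1)
next
  case (Cons F Fs)
  then have F: "F \<in> steps P" "src1 P F = p" "rseq P (tgt1 P F) Fs q" by auto
  have F2: "F \<in> cells2 P False" using steps_cells2 F by blast
  have ctx: "composable_ctx P u F v" using assms(2,3) Cons(3,4) F unfolding composable_ctx_def by simp
  have sq: "seq_cell P (tgt1 P F) Fs \<in> cells2 P False" "src1 P (seq_cell P (tgt1 P F) Fs) = tgt1 P F"
    using seq_cell_cells2[OF F(3)] by auto
  have "tgt0 u = src0 (tgt1 P F)" "tgt0 (tgt1 P F) = src0 v" using Cons(3,4) F F2 by auto
  note IH = Cons.IH[OF F(3) this]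
  show ?case
    using IH F F2 ctx whisker_steps[OF F(1) ctx] whisker_cells2[OF F2 ctx]
      whisker_vcomp[OF F2 sq(1) _ ctx] sq by simp
qed

lemmas [simp] =
  hcomp_cells2[where b = True] hcomp_cells2[where b = False]
  vcomp_cells2[where b = True] vcomp_cells2[where b = False]

text \<open>The exchange law after insertion of identities. The two decompositions are the two ways
  around the square of a Peiffer branching.\<close>

lemma hcomp_decompose:
  assumes "F \<in> cells2 P b" "G \<in> cells2 P b" "tgt0 (src1 P F) = src0 (src1 P G)"
  shows "hcomp P b F G = vcomp P b (hcomp P b F (ident1 P b (src1 P G)))
      (hcomp P b (ident1 P b (tgt1 P F)) G)"
    and "hcomp P b F G = vcomp P b (hcomp P b (ident1 P b (src1 P F)) G)
      (hcomp P b F (ident1 P b (tgt1 P G)))"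
  using assms hcomp_vcomp[of F b "ident1 P b (tgt1 P F)" "ident1 P b (src1 P G)" G]
    hcomp_vcomp[of "ident1 P b (src1 P F)" b F G "ident1 P b (tgt1 P G)"] by simp_all

text \<open>This gives the length of a 2-cell of the free 2-category. It is invariant only without
  formal inverses, since the axiom \<open>invr\<close> cancels generators.\<close>

primrec ngens :: "('v, 'e, 'a) expr2 \<Rightarrow> nat" where
  "ngens (Gen \<alpha>) = 1"
| "ngens (Idn p) = 0"
| "ngens (HC f g) = ngens f + ngens g"
| "ngens (VC f g) = ngens f + ngens g"
| "ngens (Inv f) = ngens f"

lemma eq2_ngens: "eq2 P b f g \<Longrightarrow> \<not> b \<Longrightarrow> ngens f = ngens g"
  by (induction rule: eq2.induct) auto

text \<open>A composite of identities collapses by \<open>id_HC\<close> and \<open>unitl_VC\<close>.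
  Nonidentity 2-cells thus have positive length, which makes the induction on loops
  decrease.\<close>

lemma ngens_0: "wf2 P False f \<Longrightarrow> ngens f = 0 \<Longrightarrow> eq2 P False f (Idn (esrc1 P f))"
proof (induction f)
  case (HC f g)
  then have fg: "eq2 P False f (Idn (esrc1 P f))" "eq2 P False g (Idn (esrc1 P g))" by auto
  have "eq2 P False (HC f g) (HC (Idn (esrc1 P f)) (Idn (esrc1 P g)))"
    using eq2.cong_HC[OF fg HC.prems(1)] .
  moreover have "wf2 P False (HC (Idn (esrc1 P f)) (Idn (esrc1 P g)))"
    using eq2_boundary[OF calculation] by blast
  ultimately show ?case using eq2.trans[OF _ eq2.id_HC] by simp
next
  case (VC f g)
  then have fg: "eq2 P False f (Idn (esrc1 P f))" "eq2 P False g (Idn (esrc1 P g))" by auto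
  have eq: "esrc1 P g = esrc1 P f"
    using eq2_boundary[OF fg(1)] VC.prems(1) by simp
  have "eq2 P False (VC f g) (VC (Idn (esrc1 P f)) (Idn (esrc1 P f)))"
    using eq2.cong_VC[OF fg VC.prems(1)] eq by simp
  moreover have "eq2 P False (VC (Idn (esrc1 P f)) (Idn (esrc1 P f))) (Idn (esrc1 P f))"
    using eq2.unitl_VC[of P False "Idn (esrc1 P f)"] wf2_boundary[of False f] VC.prems(1) by simp
  ultimately show ?case using eq2.trans by simp
qed (auto intro: eq2.refl)

definition len2 :: "('v, 'e, 'a) cell2 \<Rightarrow> nat" where
  "len2 F = the_elem (ngens ` F)"

lemma len2_cls2 [simp]:
  assumes "wf2 P False f"
  shows "len2 (cls2 P False f) = ngens f"
proof -
  have "ngens ` cls2 P False f = {ngens f}"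
    using assms eq2_ngens mem_cls2 unfolding cls2_def by fastforce
  then show ?thesis unfolding len2_def by simp
qed

lemma len2_vcomp:
  "F \<in> cells2 P False \<Longrightarrow> G \<in> cells2 P False \<Longrightarrow> tgt1 P F = src1 P G \<Longrightarrow>
    len2 (vcomp P False F G) = len2 F + len2 G"
  by (auto elim!: cells2E)

lemma len2_hcomp:
  "F \<in> cells2 P False \<Longrightarrow> G \<in> cells2 P False \<Longrightarrow> tgt0 (src1 P F) = src0 (src1 P G) \<Longrightarrow>
    len2 (hcomp P False F G) = len2 F + len2 G"
  by (auto elim!: cells2E)

lemma len2_ident1: "p \<in> cells1 P \<Longrightarrow> len2 (ident1 P False p) = 0"
  unfolding ident1_def by simp

lemma len2_whisker:
  assumes "F \<in> cells2 P False" "composable_ctx P u F v"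
  shows "len2 (whisker P False u F v) = len2 F"
  using assms composable_ctxD[OF assms(2)] unfolding whisker_def
  by (simp add: len2_hcomp len2_ident1)

lemma len2_0:
  assumes "F \<in> cells2 P False" "len2 F = 0"
  shows "F = ident1 P False (src1 P F)"
  using assms unfolding ident1_def by (auto elim!: cells2E simp only: len2_cls2 src1_cls2 intro!: cls2_eq ngens_0)

end

section \<open>The groupoid of 2-cells modulo 3-cells\<close>

locale extended_polygraph = polygraph P
  for P :: "('v, 'e, 'a) polygraph2" +
  fixes \<Gamma> :: "('c, ('v, 'e, 'a) cell2) globular_ext"
  assumes globular: "globular_extension P \<Gamma>"
begin

lemma cong_ext_boundary:
  "cong_ext P \<Gamma> F G \<Longrightarrow> F \<in> cells2 P True \<and> G \<in> cells2 P True \<and>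
    src1 P F = src1 P G \<and> tgt1 P F = tgt1 P G"
proof (induction rule: cong_ext.induct)
  case (gen A)
  then show ?case using globular unfolding globular_extension_def parallel2_def by blast
qed auto

text \<open>The congruence has no rule for inverses. Placing \<open>F\<close>, respectively
  \<open>G\<close>, between \<open>inv2 P F\<close> and \<open>inv2 P G\<close> gives congruent
  composites, equal to \<open>inv2 P G\<close> and \<open>inv2 P F\<close>.\<close>

lemma cong_ext_inv2:
  assumes "cong_ext P \<Gamma> F G"
  shows "cong_ext P \<Gamma> (inv2 P F) (inv2 P G)"
proof -
  note FG = cong_ext_boundary[OF assms]
  have refl: "cong_ext P \<Gamma> (inv2 P F) (inv2 P F)" "cong_ext P \<Gamma> (inv2 P G) (inv2 P G)"
    using FG by (auto intro: cong_ext.refl)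
  have "cong_ext P \<Gamma> (vcomp P True (vcomp P True (inv2 P F) F) (inv2 P G))
      (vcomp P True (vcomp P True (inv2 P F) G) (inv2 P G))"
    using FG ident1_cells2(3)[of "tgt1 P G" True] by (intro cong_ext.vcomp refl assms) simp_all
  moreover have "vcomp P True (vcomp P True (inv2 P F) F) (inv2 P G) = inv2 P G"
    using FG vcomp_ident(1)[of "inv2 P G" True] by simp
  moreover have "vcomp P True (vcomp P True (inv2 P F) G) (inv2 P G) = inv2 P F"
    using FG vcomp_ident(2)[of "inv2 P F" True] by (simp add: vcomp_assoc[where b=True])
  ultimately show ?thesis using cong_ext.sym by metis
qed

lemma cong_ext_whisker:
  assumes "cong_ext P \<Gamma> F G" "composable_ctx P u F v"
  shows "cong_ext P \<Gamma> (whisker P True u F v) (whisker P True u G v)"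
proof -
  have "cong_ext P \<Gamma> (hcomp P True (ident1 P True u) F) (hcomp P True (ident1 P True u) G)"
    using composable_ctxD[OF assms(2)]
    by (intro cong_ext.hcomp assms(1) cong_ext.refl) simp_all
  from cong_ext.hcomp[OF this cong_ext.refl[of "ident1 P True v"]] show ?thesis
    using composable_ctxD[OF assms(2)] cong_ext_boundary[OF assms(1)] unfolding whisker_def
    by simp
qed

definition class3 :: "('v, 'e, 'a) cell2 \<Rightarrow> ('v, 'e, 'a) cell2 set" where
  "class3 F = {G. cong_ext P \<Gamma> F G}"

definition hom3 :: "('v, 'e) cell1 \<Rightarrow> ('v, 'e) cell1 \<Rightarrow> ('v, 'e, 'a) cell2 set set" where
  "hom3 u v = class3 ` {F \<in> cells2 P True. src1 P F = u \<and> tgt1 P F = v}"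

definition comp3 :: "('v, 'e, 'a) cell2 set \<Rightarrow> ('v, 'e, 'a) cell2 set \<Rightarrow> ('v, 'e, 'a) cell2 set" where
  "comp3 X Y = (\<Union>F\<in>X. \<Union>G\<in>Y. class3 (vcomp P True F G))"

definition inv3 :: "('v, 'e, 'a) cell2 set \<Rightarrow> ('v, 'e, 'a) cell2 set" where
  "inv3 X = (\<Union>F\<in>X. class3 (inv2 P F))"

lemma mem_class3: "F \<in> cells2 P True \<Longrightarrow> F \<in> class3 F"
  unfolding class3_def by (simp add: cong_ext.refl)

lemma class3_eqI: "cong_ext P \<Gamma> F G \<Longrightarrow> class3 F = class3 G"
  unfolding class3_def using cong_ext.sym cong_ext.trans by blast

lemma class3_eqD: "G \<in> cells2 P True \<Longrightarrow> class3 F = class3 G \<Longrightarrow> cong_ext P \<Gamma> F G"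
  using mem_class3 unfolding class3_def by blast

lemma comp3_class3 [simp]:
  assumes "F \<in> cells2 P True" "G \<in> cells2 P True" "tgt1 P F = src1 P G"
  shows "comp3 (class3 F) (class3 G) = class3 (vcomp P True F G)"
proof -
  have "class3 (vcomp P True F' G') = class3 (vcomp P True F G)"
    if "F' \<in> class3 F" "G' \<in> class3 G" for F' G'
    using class3_eqI[OF cong_ext.vcomp] assms(3) that unfolding class3_def by fastforce
  then show ?thesis using mem_class3 assms(1,2) unfolding comp3_def by blast
qed

lemma inv3_class3 [simp]:
  assumes "F \<in> cells2 P True"
  shows "inv3 (class3 F) = class3 (inv2 P F)"
proof -
  have "class3 (inv2 P F') = class3 (inv2 P F)" if "F' \<in> class3 F" for F'
    using class3_eqI[OF cong_ext_inv2] that unfolding class3_def by fastforce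
  then show ?thesis using mem_class3 assms unfolding inv3_def by blast
qed

lemma class3_hom3: "F \<in> cells2 P True \<Longrightarrow> class3 F \<in> hom3 (src1 P F) (tgt1 P F)"
  unfolding hom3_def by blast

lemma hom3E:
  assumes "x \<in> hom3 u v"
  obtains F where "F \<in> cells2 P True" "src1 P F = u" "tgt1 P F = v" "x = class3 F"
  using assms unfolding hom3_def by blast

text \<open>Only composition along 1-cells is retained: objects are 1-cells and morphisms are
  classes of 2-cells. Composition along 0-cells enters later through whiskering.\<close>

sublocale Q: groupoid "cells1 P" hom3 "\<lambda>u. class3 (ident1 P True u)" comp3 inv3
proof
  fix x u v assume "x \<in> hom3 u v"
  then obtain F where F: "F \<in> cells2 P True" "src1 P F = u" "tgt1 P F = v" "x = class3 F"
    by (rule hom3E)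
  show "u \<in> cells1 P \<and> v \<in> cells1 P" using F boundary_cells1[OF F(1)] by simp
  show "inv3 x \<in> hom3 v u" using F class3_hom3[of "inv2 P F"] by simp
  show "comp3 (class3 (ident1 P True u)) x = x" "comp3 x (class3 (ident1 P True v)) = x"
    "comp3 x (inv3 x) = class3 (ident1 P True u)" "comp3 (inv3 x) x = class3 (ident1 P True v)"
    using F(1) unfolding F(2-4)[symmetric] by (simp_all add: F(4))
next
  fix u assume "u \<in> cells1 P"
  then show "class3 (ident1 P True u) \<in> hom3 u u" using class3_hom3[of "ident1 P True u"] by simp
next
  fix x y u v w assume "x \<in> hom3 u v" "y \<in> hom3 v w"
  then obtain F G where "F \<in> cells2 P True" "src1 P F = u" "tgt1 P F = v" "x = class3 F"
    "G \<in> cells2 P True" "src1 P G = v" "tgt1 P G = w" "y = class3 G" by (auto elim!: hom3E)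
  then show "comp3 x y \<in> hom3 u w" using class3_hom3[of "vcomp P True F G"] by simp
next
  fix x y z u v w t assume "x \<in> hom3 u v" "y \<in> hom3 v w" "z \<in> hom3 w t"
  then obtain F G H where "F \<in> cells2 P True" "src1 P F = u" "tgt1 P F = v" "x = class3 F"
    "G \<in> cells2 P True" "src1 P G = v" "tgt1 P G = w" "y = class3 G"
    "H \<in> cells2 P True" "src1 P H = w" "tgt1 P H = t" "z = class3 H"
    by (auto elim!: hom3E)
  then show "comp3 (comp3 x y) z = comp3 x (comp3 y z)" by (simp add: vcomp_assoc)
qed

section \<open>From congruence of 2-cells to 3-cells\<close>

lemma wf3_boundary:
  "wf3 P \<Gamma> x \<Longrightarrow> esrc2 P \<Gamma> x \<in> cells2 P True \<and> etgt2 P \<Gamma> x \<in> cells2 P True \<and>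
    src1 P (etgt2 P \<Gamma> x) = src1 P (esrc2 P \<Gamma> x) \<and> tgt1 P (etgt2 P \<Gamma> x) = tgt1 P (esrc2 P \<Gamma> x)"
proof (induction x)
  case (Gen3 A)
  then show ?case using globular unfolding globular_extension_def parallel2_def by simp
qed simp_all

lemma eq3_boundary:
  "eq3 P \<Gamma> x y \<Longrightarrow> wf3 P \<Gamma> x \<and> wf3 P \<Gamma> y \<and> esrc2 P \<Gamma> x = esrc2 P \<Gamma> y \<and> etgt2 P \<Gamma> x = etgt2 P \<Gamma> y"
proof (induction rule: eq3.induct)
  case (unitl_C0 x)
  note * = wf3_boundary[OF unitl_C0]
  then show ?case using unitl_C0 ident0_cells1[of "src1 P (esrc2 P \<Gamma> x)"]
      hcomp_ident(1)[of "esrc2 P \<Gamma> x" True] hcomp_ident(1)[of "etgt2 P \<Gamma> x" True] by simp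
next
  case (unitr_C0 x)
  note * = wf3_boundary[OF unitr_C0]
  then show ?case using unitr_C0 ident0_cells1[of "src1 P (esrc2 P \<Gamma> x)"]
      hcomp_ident(2)[of "esrc2 P \<Gamma> x" True] hcomp_ident(2)[of "etgt2 P \<Gamma> x" True] by simp
next
  case (unitl_C1 x)
  note * = wf3_boundary[OF unitl_C1]
  then show ?case using unitl_C1
      vcomp_ident(1)[of "esrc2 P \<Gamma> x" True] vcomp_ident(1)[of "etgt2 P \<Gamma> x" True] by simp
next
  case (unitr_C1 x)
  note * = wf3_boundary[OF unitr_C1]
  then show ?case using unitr_C1
      vcomp_ident(2)[of "esrc2 P \<Gamma> x" True] vcomp_ident(2)[of "etgt2 P \<Gamma> x" True] by simp
next
  case (assoc_C0 x y z)
  then have wf: "wf3 P \<Gamma> x" "wf3 P \<Gamma> y" "wf3 P \<Gamma> z" by auto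
  note bd = wf3_boundary[OF wf(1)] wf3_boundary[OF wf(2)] wf3_boundary[OF wf(3)]
  have "tgt0 (src1 P (esrc2 P \<Gamma> x)) = src0 (src1 P (esrc2 P \<Gamma> y))" using assoc_C0 by simp
  moreover from this have "tgt0 (src1 P (esrc2 P \<Gamma> y)) = src0 (src1 P (esrc2 P \<Gamma> z))"
    using assoc_C0 bd by simp
  ultimately show ?case using wf bd by (simp add: hcomp_assoc[where b=True])
next
  case (assoc_C1 x y z)
  then have wf: "wf3 P \<Gamma> x" "wf3 P \<Gamma> y" "wf3 P \<Gamma> z" by auto
  note bd = wf3_boundary[OF wf(1)] wf3_boundary[OF wf(2)] wf3_boundary[OF wf(3)]
  have "tgt1 P (esrc2 P \<Gamma> x) = src1 P (esrc2 P \<Gamma> y)" using assoc_C1 by simp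
  moreover from this have "tgt1 P (esrc2 P \<Gamma> y) = src1 P (esrc2 P \<Gamma> z)"
    using assoc_C1 bd by simp
  ultimately show ?case using wf bd by (simp add: vcomp_assoc[where b=True])
next
  case (exchange_01 x y z w)
  then have wf: "wf3 P \<Gamma> x" "wf3 P \<Gamma> y" "wf3 P \<Gamma> z" "wf3 P \<Gamma> w"
    and vcomp: "tgt1 P (esrc2 P \<Gamma> x) = src1 P (esrc2 P \<Gamma> y)"
      "tgt1 P (esrc2 P \<Gamma> z) = src1 P (esrc2 P \<Gamma> w)" by auto
  note bd = wf3_boundary[OF wf(1)] wf3_boundary[OF wf(2)] wf3_boundary[OF wf(3)]
    wf3_boundary[OF wf(4)]
  have hcomp: "tgt0 (src1 P (esrc2 P \<Gamma> x)) = src0 (src1 P (esrc2 P \<Gamma> z))"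
    using exchange_01 bd vcomp by simp
  have "tgt0 (src1 P (esrc2 P \<Gamma> y)) = src0 (src1 P (esrc2 P \<Gamma> w))"
    using hcomp vcomp bd boundary_tgt1[of "esrc2 P \<Gamma> x" True] boundary_tgt1[of "esrc2 P \<Gamma> z" True]
    by simp
  then show ?case using wf bd vcomp hcomp by (simp add: hcomp_vcomp[where b=True])
next
  case (exchange_02 x y z w)
  then show ?case
    using wf3_boundary[of x] wf3_boundary[of y] wf3_boundary[of z] wf3_boundary[of w] by simp
next
  case (exchange_12 x y z w)
  then show ?case
    using wf3_boundary[of x] wf3_boundary[of y] wf3_boundary[of z] wf3_boundary[of w] by simp
qed (auto dest: wf3_boundary)

text \<open>Each rule of the congruence matches a constructor of 3-cells, symmetry being
  \<open>Inv3\<close> and transitivity \<open>C2\<close>. Filling a 2-sphere thus reduces to a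
  congruence.\<close>

lemma cong_ext_expr3: "cong_ext P \<Gamma> F G \<Longrightarrow> \<exists>x. wf3 P \<Gamma> x \<and> esrc2 P \<Gamma> x = F \<and> etgt2 P \<Gamma> x = G"
proof (induction rule: cong_ext.induct)
  case (gen A)
  then show ?case by (intro exI[of _ "Gen3 A"]) simp
next
  case (refl F)
  then show ?case by (intro exI[of _ "Idn3 F"]) simp
next
  case (sym F G)
  then show ?case by (metis wf3.simps(6) esrc2.simps(6) etgt2.simps(6))
next
  case (trans F G H)
  then show ?case by (metis wf3.simps(5) esrc2.simps(5) etgt2.simps(5))
next
  case (hcomp F F' G G')
  then show ?case by (metis wf3.simps(3) esrc2.simps(3) etgt2.simps(3))
next
  case (vcomp F F' G G')
  then show ?case by (metis wf3.simps(4) esrc2.simps(4) etgt2.simps(4))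
qed

lemma cong_ext_cells3:
  assumes "cong_ext P \<Gamma> F G"
  shows "\<exists>X\<in>cells3 P \<Gamma>. src2 P \<Gamma> X = F \<and> tgt2 P \<Gamma> X = G"
proof -
  obtain x where x: "wf3 P \<Gamma> x" "esrc2 P \<Gamma> x = F" "etgt2 P \<Gamma> x = G"
    using cong_ext_expr3[OF assms] by blast
  let ?X = "{y. eq3 P \<Gamma> x y}"
  have "esrc2 P \<Gamma> ` ?X = {F}" "etgt2 P \<Gamma> ` ?X = {G}"
    using eq3_boundary[of x] eq3.refl[OF x(1)] x(2,3) by (auto simp: image_iff)
  then have "src2 P \<Gamma> ?X = F" "tgt2 P \<Gamma> ?X = G" unfolding src2_def tgt2_def by simp_all
  then show ?thesis using x(1) unfolding cells3_def by blast
qed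

end


section \<open>Triviality of loops\<close>

context extended_polygraph
begin

abbreviation null :: "('v, 'e, 'a) cell2 \<Rightarrow> bool" where
  "null F \<equiv> class3 (incl2 P F) = class3 (ident1 P True (src1 P F))"

text \<open>Rotation replaces a composite of two paths by the composite in the other order, and
  \<open>conjugate_one\<close> says that one is trivial when the other is.\<close>

lemma null_rotated:
  assumes "rotated P F G" "null G"
  shows "null F"
proof -
  obtain p q Fs Gs where *: "rseq P p Fs q" "rseq P q Gs p"
    "F = seq_cell P p (Fs @ Gs)" "G = seq_cell P q (Gs @ Fs)"
    using assms(1) unfolding rotated_def by blast
  let ?X = "seq_cell P p Fs" and ?Y = "seq_cell P q Gs"
  have X: "?X \<in> cells2 P False" "src1 P ?X = p" "tgt1 P ?X = q"
    and Y: "?Y \<in> cells2 P False" "src1 P ?Y = q" "tgt1 P ?Y = p"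
    using seq_cell_cells2 *(1,2) by auto
  have F: "F = vcomp P False ?X ?Y" and G: "G = vcomp P False ?Y ?X"
    using seq_cell_append * by auto
  have x: "class3 (incl2 P ?X) \<in> hom3 p q" and y: "class3 (incl2 P ?Y) \<in> hom3 q p"
    using class3_hom3[of "incl2 P ?X"] class3_hom3[of "incl2 P ?Y"] X Y by auto
  have "comp3 (class3 (incl2 P ?Y)) (class3 (incl2 P ?X)) = class3 (ident1 P True q)"
    using assms(2) X Y unfolding G by (simp add: incl2_vcomp)
  from Q.conjugate_one[OF x y this] show ?thesis
    using X Y unfolding F by (simp add: incl2_vcomp)
qed

text \<open>Lexicographic induction on the length of the loop and the length of its source. A loop
  not minimal for composition splits into two shorter loops; one not minimal by context is a
  whiskered loop of the same length with a shorter source.\<close>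

lemma null_loop:
  assumes elementary: "\<And>F. F \<in> elementary_loops P \<Longrightarrow> null F"
  shows "F \<in> loops P \<Longrightarrow> null F"
proof (induction F rule:
    wf_induct_rule[OF wf_measures[of "[len2, \<lambda>F. length (fst (snd (src1 P F)))]"]])
  case (1 F)
  have F: "F \<in> cells2 P False" "tgt1 P F = src1 P F" using 1(2) unfolding loops_def by auto
  consider "F \<in> elementary_loops P" | "\<not> minimal_1comp P F" | "\<not> minimal_ctx P F"
    using 1(2) unfolding elementary_loops_def by blast
  then show ?case
  proof cases
    case 1
    then show ?thesis by (rule elementary)
  next
    case 2
    then obtain G H K where *: "G \<in> cells2 P False" "H \<in> loops P" "K \<in> cells2 P False"
      "tgt1 P G = src1 P H" "tgt1 P H = src1 P K" "F = vcomp P False (vcomp P False G H) K"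
      "H \<notin> ident1 P False ` cells1 P" "H \<noteq> F"
      unfolding minimal_1comp_def by blast
    have H: "H \<in> cells2 P False" "tgt1 P H = src1 P H" using *(2) unfolding loops_def by auto
    have len: "len2 F = len2 G + len2 H + len2 K"
      unfolding *(6) using * H by (simp add: len2_vcomp)
    have "len2 H \<noteq> 0" using len2_0[OF H(1)] *(7) boundary_cells1(1)[OF H(1)] by (metis imageI)
    \<comment> \<open>If both outer factors had length zero, they would be identities and
      \<open>H\<close> would be \<open>F\<close>.\<close>
    have "len2 G \<noteq> 0 \<or> len2 K \<noteq> 0"
    proof (rule ccontr)
      assume "\<not> ?thesis"
      then have "G = ident1 P False (src1 P G)" "K = ident1 P False (src1 P K)"
        using len2_0 *(1,3) by auto
      then have "G = ident1 P False (src1 P H)" "K = ident1 P False (tgt1 P H)"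
        using *(1,3-5) by (metis ident1_cells2(3) boundary_cells1(1))+
      then have "F = H" using *(6) H(1) by (simp add: vcomp_ident[OF H(1)])
      with *(8) show False by simp
    qed
    \<comment> \<open>Cutting \<open>H\<close> out of \<open>F\<close> leaves a loop again, shorter
      because \<open>H\<close> has positive length.\<close>
    let ?E = "vcomp P False G K"
    have src: "src1 P F = src1 P G" "tgt1 P K = src1 P G" using * H F by auto
    have "null H"
      using 1(1)[of H] *(2) len \<open>len2 G \<noteq> 0 \<or> len2 K \<noteq> 0\<close> by auto
    moreover have "null ?E"
    proof (rule 1(1))
      show "?E \<in> loops P" using * H src unfolding loops_def by simp
      show "(?E, F) \<in> measures [len2, \<lambda>F. length (fst (snd (src1 P F)))]"
        using len \<open>len2 H \<noteq> 0\<close> * H src by (simp add: len2_vcomp)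
    qed
    moreover have "class3 (incl2 P F)
        = comp3 (comp3 (class3 (incl2 P G)) (class3 (incl2 P H))) (class3 (incl2 P K))"
      unfolding *(6) using *(1,3-5) H by (simp add: incl2_vcomp)
    ultimately show ?thesis
      using src * H vcomp_ident(2)[of "incl2 P G" True] by (simp add: incl2_vcomp)
  next
    case 3
    then obtain u v G where *: "G \<in> loops P" "u \<notin> range ident0" "v \<notin> range ident0"
      "composable_ctx P u G v" "F = whisker P False u G v"
      unfolding minimal_ctx_def by blast
    have G: "G \<in> cells2 P False" "tgt1 P G = src1 P G" using *(1) unfolding loops_def by auto
    note ctx = composable_ctxD[OF *(4)]
    \<comment> \<open>A nonidentity 1-cell is a nonempty walk, so removing the context shortens the
      source.\<close>
    have "fst (snd u) \<noteq> []" using cells1_Nil(1)[of u] ctx *(2) by (metis rangeI)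
    then have "length (fst (snd (src1 P G))) < length (fst (snd (src1 P F)))"
      unfolding *(5) whisker_cells2(2)[OF G(1) *(4)] by simp
    moreover have "len2 F = len2 G" unfolding *(5) using len2_whisker G(1) *(4) by blast
    ultimately have "null G" using 1(1)[of G] *(1) by simp
    then have "cong_ext P \<Gamma> (incl2 P G) (ident1 P True (src1 P G))"
      using class3_eqD G(1) by simp
    from cong_ext_whisker[OF this] have "class3 (whisker P True u (incl2 P G) v)
        = class3 (whisker P True u (ident1 P True (src1 P G)) v)"
      using class3_eqI composable_ctx_cong[OF *(4)] G(1) by simp
    then show ?thesis
      unfolding *(5) using whisker_cells2[OF G(1) *(4)] incl2_whisker[OF G(1) *(4)]
        whisker_ident1[of "src1 P G" u v True] ctx G(1) by simp
  qed
qed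

end


section \<open>Local branchings and zigzags of steps\<close>

locale labelled_polygraph = extended_polygraph P \<Gamma>
  for P :: "('v, 'e, 'a) polygraph2" and \<Gamma> :: "('c, ('v, 'e, 'a) cell2) globular_ext" +
  fixes r :: "('w \<times> 'w) set" and \<psi> :: "('v, 'e, 'a) cell2 \<Rightarrow> 'w"
  assumes wf_labels: "wf r"
    and compatible: "compatible_with_contexts P r \<psi>"
begin

sublocale S: decreasing_groupoid "cells1 P" hom3 "\<lambda>u. class3 (ident1 P True u)" comp3 inv3
  "steps P" "src1 P" "tgt1 P" "\<lambda>F. class3 (incl2 P F)" \<psi> r
proof
  fix F assume "F \<in> steps P"
  then show "class3 (incl2 P F) \<in> hom3 (src1 P F) (tgt1 P F)"
    using class3_hom3[of "incl2 P F"] steps_cells2[of F] by simp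
qed (rule wf_labels)

section \<open>Zigzags of rewriting steps\<close>

lemma rseq_pos:
  "rseq P p Fs q \<Longrightarrow> \<psi> ` set Fs \<subseteq> D \<Longrightarrow> S.pos D p (class3 (incl2 P (seq_cell P p Fs))) q"
proof (induction Fs arbitrary: p)
  case Nil
  then have "p \<in> cells1 P" "q = p" unfolding rseq.simps by blast+
  then show ?case using S.pos_one by simp
next
  case (Cons F Fs)
  then have F: "F \<in> steps P" "src1 P F = p" "rseq P (tgt1 P F) Fs q" "\<psi> F \<in> D" by auto
  have "S.pos D (tgt1 P F) (class3 (incl2 P (seq_cell P (tgt1 P F) Fs))) q"
    using Cons F(3) by simp
  from S.pos_step[OF F(1,4) this] show ?case
    using F(2) steps_cells2[OF F(1)] seq_cell_cells2[OF F(3)] by (simp add: incl2_vcomp)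
qed

text \<open>A directed path uses no inverses, so its value comes from the free 2-category; for a
  closed path this yields a 2-loop.\<close>

lemma pos_cells2:
  "S.pos D u x v \<Longrightarrow> \<exists>F\<in>cells2 P False. src1 P F = u \<and> tgt1 P F = v \<and> x = class3 (incl2 P F)"
proof (induction rule: S.pos.induct)
  case (pos_one u)
  then show ?case by (intro bexI[of _ "ident1 P False u"]) simp_all
next
  case (pos_step F x v)
  then obtain G where "G \<in> cells2 P False" "src1 P G = tgt1 P F" "tgt1 P G = v" "x = class3 (incl2 P G)"
    by blast
  then show ?case using steps_cells2[OF pos_step(1)]
    by (intro bexI[of _ "vcomp P False F G"]) (simp_all add: incl2_vcomp)
qed

text \<open>The contexts are arbitrary because a horizontal composite is handled by whiskering its
  factors, each of which then sits in a larger context. A generator in context is a single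
  step.\<close>

lemma zig_whisker:
  assumes "wf2 P True f" "composable_ctx P u (cls2 P True f) v"
  shows "S.zig UNIV (comp1 (comp1 u (esrc1 P f)) v)
    (class3 (whisker P True u (cls2 P True f) v)) (comp1 (comp1 u (etgt1 P f)) v)"
  using assms
proof (induction f arbitrary: u v)
  case (Gen \<alpha>)
  let ?g = "gen2 P False \<alpha>"
  have g: "?g \<in> steps P" "src1 P ?g = gsrc1 P \<alpha>" "tgt1 P ?g = gtgt1 P \<alpha>"
    using gen2_steps gen2_cells2 Gen by auto
  have g2: "?g \<in> cells2 P False" using steps_cells2 g(1) by blast
  have ctx: "composable_ctx P u ?g v" using Gen g composable_ctx_cong[OF Gen(2)] by simp
  have eq: "incl2 P ?g = cls2 P True (Gen \<alpha>)" using Gen unfolding gen2_def by simp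
  show ?case
    using S.zig_single[OF whisker_steps[OF g(1) ctx], of UNIV] whisker_cells2[OF g2 ctx]
      incl2_whisker[OF g2 ctx] g(2,3) eq by simp
next
  case (Idn p)
  have "whisker P True u (cls2 P True (Idn p)) v = ident1 P True (comp1 (comp1 u p) v)"
    using whisker_ident1[of p u v True] composable_ctxD[OF Idn(2)] Idn(1)
    unfolding ident1_def by simp
  then show ?case
    using S.zig_one[of "comp1 (comp1 u p) v" UNIV] composable_ctxD[OF Idn(2)] Idn(1) comp1_cells1
    by simp
next
  case (HC f g)
  let ?F = "cls2 P True f" and ?G = "cls2 P True g"
  have fg: "wf2 P True f" "wf2 P True g" "tgt0 (esrc1 P f) = src0 (esrc1 P g)" using HC.prems by auto
  have FG: "?F \<in> cells2 P True" "?G \<in> cells2 P True" "tgt0 (src1 P ?F) = src0 (src1 P ?G)"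
    using fg by auto
  have uv: "u \<in> cells1 P" "v \<in> cells1 P" "tgt0 u = src0 (esrc1 P f)" "tgt0 (esrc1 P g) = src0 v"
    using composable_ctxD[OF HC.prems(2)] HC.prems(1) by auto
  note bd = wf2_boundary[OF fg(1)] wf2_boundary[OF fg(2)]
  have cF: "composable_ctx P u ?F (comp1 (esrc1 P g) v)"
    and cG: "composable_ctx P (comp1 u (etgt1 P f)) ?G v"
    using uv fg bd unfolding composable_ctx_def by (auto intro!: comp1_cells1)
  \<comment> \<open>The left factor is applied first, next to the source of \<open>g\<close>; then
    the right factor, next to the target of \<open>f\<close>.\<close>
  let ?A = "hcomp P True ?F (ident1 P True (src1 P ?G))"
    and ?B = "hcomp P True (ident1 P True (tgt1 P ?F)) ?G"
  have AB: "?A \<in> cells2 P True" "?B \<in> cells2 P True" "tgt1 P ?A = src1 P ?B"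
    "src1 P ?A = comp1 (src1 P ?F) (src1 P ?G)" "tgt1 P ?B = comp1 (tgt1 P ?F) (tgt1 P ?G)"
    using FG by simp_all
  have id: "ident0 (src0 (src1 P ?F)) \<in> cells1 P" "ident0 (tgt0 (src1 P ?G)) \<in> cells1 P"
    using FG ident0_cells1 by auto
  have A: "?A = whisker P True (ident0 (src0 (src1 P ?F))) ?F (src1 P ?G)"
    using FG unfolding whisker_def by simp
  have B: "?B = whisker P True (tgt1 P ?F) ?G (ident0 (tgt0 (src1 P ?G)))"
    using FG hcomp_ident(2)[of ?B] unfolding whisker_def by simp
  have cu: "composable_ctx P u ?A v" using uv AB fg unfolding composable_ctx_def by simp
  have cu': "composable_ctx P u ?B v" using uv AB fg bd unfolding composable_ctx_def by simp
  have "composable_ctx P (ident0 (src0 (src1 P ?F))) ?F (src1 P ?G)"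
    using FG id unfolding composable_ctx_def by simp
  then have wA: "whisker P True u ?A v = whisker P True u ?F (comp1 (esrc1 P g) v)"
    using whisker_whisker[OF FG(1)] cu comp1_ident0(2)[of u] uv(3) fg unfolding A by simp
  have "composable_ctx P (tgt1 P ?F) ?G (ident0 (tgt0 (src1 P ?G)))"
    using FG id unfolding composable_ctx_def by simp
  then have wB: "whisker P True u ?B v = whisker P True (comp1 u (etgt1 P f)) ?G v"
    using whisker_whisker[OF FG(2)] cu' comp1_ident0(1)[of v] uv(4) fg unfolding B by simp
  have "cls2 P True (HC f g) = vcomp P True ?A ?B"
    using hcomp_decompose(1)[OF FG] HC.prems(1) by simp
  then have "whisker P True u (cls2 P True (HC f g)) v =
      vcomp P True (whisker P True u ?A v) (whisker P True u ?B v)"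
    using whisker_vcomp[OF AB(1-3) cu] by simp
  moreover have "S.zig UNIV (comp1 (comp1 u (esrc1 P (HC f g))) v)
      (class3 (whisker P True u ?A v)) (tgt1 P (whisker P True u ?A v))"
    using HC.IH(1)[OF fg(1) cF] whisker_cells2[OF AB(1) cu] wA AB fg bd
    by (simp add: comp1_assoc)
  moreover have "S.zig UNIV (tgt1 P (whisker P True u ?A v))
      (class3 (whisker P True u ?B v)) (comp1 (comp1 u (etgt1 P (HC f g))) v)"
    using HC.IH(2)[OF fg(2) cG] whisker_cells2[OF AB(1) cu] wB AB fg bd
    by (simp add: comp1_assoc)
  moreover have "class3 (vcomp P True (whisker P True u ?A v) (whisker P True u ?B v))
      = comp3 (class3 (whisker P True u ?A v)) (class3 (whisker P True u ?B v))"
    using whisker_cells2[OF AB(1) cu] whisker_cells2[OF AB(2) cu'] AB(3) by simp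
  ultimately show ?case using S.zig_trans by metis
next
  case (VC f g)
  let ?F = "cls2 P True f" and ?G = "cls2 P True g"
  have fg: "wf2 P True f" "wf2 P True g" "etgt1 P f = esrc1 P g" using VC.prems by auto
  note bd = wf2_boundary[OF fg(1)] wf2_boundary[OF fg(2)]
  have cF: "composable_ctx P u ?F v" and cG: "composable_ctx P u ?G v"
    using composable_ctx_cong[OF VC.prems(2)] VC.prems(1) fg bd by auto
  have "whisker P True u (cls2 P True (VC f g)) v
      = vcomp P True (whisker P True u ?F v) (whisker P True u ?G v)"
    using whisker_vcomp[of ?F True ?G u v] cF fg VC.prems(1) by simp
  moreover have "comp3 (class3 (whisker P True u ?F v)) (class3 (whisker P True u ?G v))
      = class3 (vcomp P True (whisker P True u ?F v) (whisker P True u ?G v))"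
    using whisker_cells2[OF _ cF, of True] whisker_cells2[OF _ cG, of True] fg
    by (intro comp3_class3) simp_all
  moreover note S.zig_trans[OF VC.IH(1)[OF fg(1) cF, unfolded fg(3)] VC.IH(2)[OF fg(2) cG]]
  ultimately show ?case by simp
next
  case (Inv f)
  let ?F = "cls2 P True f"
  have f: "wf2 P True f" using Inv.prems(1) by simp
  have ctx: "composable_ctx P u ?F v"
    using composable_ctx_cong[OF Inv.prems(2)] Inv.prems(1) f wf2_boundary[OF f] by simp
  have "whisker P True u (cls2 P True (Inv f)) v = inv2 P (whisker P True u ?F v)"
    using whisker_inv2[OF _ ctx] f by simp
  then show ?case
    using S.zig_inv[OF Inv.IH[OF f ctx]] whisker_cells2[OF _ ctx, of True] f by simp
qed

lemma zig_cells2: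
  assumes "F \<in> cells2 P True"
  shows "S.zig UNIV (src1 P F) (class3 F) (tgt1 P F)"
proof -
  obtain f where f: "wf2 P True f" "F = cls2 P True f" using assms by (rule cells2E)
  let ?u = "ident0 (src0 (src1 P F))" and ?v = "ident0 (tgt0 (src1 P F))"
  have "composable_ctx P ?u (cls2 P True f) ?v"
    using f ident0_cells1[OF boundary_cells1(1)[OF assms]] unfolding composable_ctx_def by simp
  note zig = zig_whisker[OF f(1) this]
  have "comp1 (comp1 ?u (src1 P F)) ?v = src1 P F" "comp1 (comp1 ?u (tgt1 P F)) ?v = tgt1 P F"
    by (metis boundary_tgt1[OF assms] comp1_ident0)+
  then show ?thesis
    using zig whisker_ident0[OF assms] src1_cls2[OF f(1)] tgt1_cls2[OF f(1)] unfolding f(2)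
    by metis
qed

text \<open>Decreasingness and commutation modulo \<Gamma> are required of the same diagram; strict
  decreasingness of the polygraph alone gives a diagram without a filler.\<close>

definition coherent_sd :: "('v, 'e, 'a) cell2 \<Rightarrow> ('v, 'e, 'a) cell2 \<Rightarrow> bool" where
  "coherent_sd F G \<longleftrightarrow> (\<exists>Fs Gs. sd_diagram P r \<psi> F Fs G Gs \<and>
     cong_ext P \<Gamma> (incl2 P (seq_cell P (src1 P F) (F # Fs)))
       (incl2 P (seq_cell P (src1 P G) (G # Gs))))"

lemma coherent_sdE:
  assumes "coherent_sd F G"
  obtains Fs Gs q where "sd_diagram P r \<psi> F Fs G Gs"
    "F \<in> steps P" "G \<in> steps P" "src1 P G = src1 P F"
    "rseq P (tgt1 P F) Fs q" "rseq P (tgt1 P G) Gs q"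
    "cong_ext P \<Gamma> (incl2 P (seq_cell P (src1 P F) (F # Fs)))
       (incl2 P (seq_cell P (src1 P G) (G # Gs)))"
proof -
  obtain Fs Gs where *: "sd_diagram P r \<psi> F Fs G Gs"
    "cong_ext P \<Gamma> (incl2 P (seq_cell P (src1 P F) (F # Fs)))
       (incl2 P (seq_cell P (src1 P G) (G # Gs)))"
    using assms unfolding coherent_sd_def by blast
  moreover obtain q where "rseq P (tgt1 P F) Fs q" "rseq P (tgt1 P G) Gs q"
    using *(1) unfolding sd_diagram_def confluence_diagram_def by blast
  moreover have "F \<in> steps P" "G \<in> steps P" "src1 P G = src1 P F"
    using *(1) unfolding sd_diagram_def confluence_diagram_def local_branching_def by simp_all
  ultimately show thesis using that by blast
qed

lemma coherent_sd_sym: "coherent_sd F G \<Longrightarrow> coherent_sd G F"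
  unfolding coherent_sd_def sd_diagram_def confluence_diagram_def local_branching_def
  by (metis cong_ext.sym)

lemma coherent_sd_refl:
  assumes "F \<in> steps P"
  shows "coherent_sd F F"
proof -
  have "rseq P (tgt1 P F) [] (tgt1 P F)" using steps_cells2[OF assms] by simp
  then have "confluence_diagram P F [] F []"
    using assms unfolding confluence_diagram_def local_branching_def by blast
  then have "sd_diagram P r \<psi> F [] F []" unfolding sd_diagram_def by simp
  moreover have "cong_ext P \<Gamma> (incl2 P (seq_cell P (src1 P F) [F])) (incl2 P (seq_cell P (src1 P F) [F]))"
    using steps_cells2[OF assms] by (intro cong_ext.refl) simp
  ultimately show ?thesis unfolding coherent_sd_def by blast
qed

text \<open>Compatibility of \<psi> with contexts preserves decreasingness of the diagram, and the
  congruence is stable under whiskering.\<close>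

lemma coherent_sd_whisker:
  assumes "coherent_sd F G" "composable_ctx P u F v"
  shows "coherent_sd (whisker P False u F v) (whisker P False u G v)"
proof -
  obtain Fs Gs q where *: "sd_diagram P r \<psi> F Fs G Gs"
    "F \<in> steps P" "G \<in> steps P" "src1 P G = src1 P F"
    "rseq P (tgt1 P F) Fs q" "rseq P (tgt1 P G) Gs q"
    "cong_ext P \<Gamma> (incl2 P (seq_cell P (src1 P F) (F # Fs)))
       (incl2 P (seq_cell P (src1 P G) (G # Gs)))"
    using assms(1) by (rule coherent_sdE)
  let ?w = "\<lambda>F. whisker P False u F v"
  let ?f = "seq_cell P (src1 P F) (F # Fs)" and ?g = "seq_cell P (src1 P G) (G # Gs)"
  have rs: "rseq P (src1 P F) (F # Fs) q" "rseq P (src1 P G) (G # Gs) q" using * by simp_all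
  have ctx: "u \<in> cells1 P" "v \<in> cells1 P" "tgt0 u = src0 (src1 P F)" "tgt0 (src1 P F) = src0 v"
    using composable_ctxD[OF assms(2)] by auto
  have ctxG: "composable_ctx P u G v" using composable_ctx_cong[OF assms(2)] *(4) by simp
  have f: "?f \<in> cells2 P False" "src1 P ?f = src1 P F"
    and g: "?g \<in> cells2 P False" "src1 P ?g = src1 P G"
    using seq_cell_cells2 rs by blast+
  have cf: "composable_ctx P u ?f v" using composable_ctx_cong[OF assms(2)] f(2) by simp
  have cg: "composable_ctx P u ?g v" using composable_ctx_cong[OF ctxG] g(2) by simp
  have "seq_cell P (src1 P (?w F)) (?w F # map ?w Fs) = ?w ?f"
    using whisker_rseq[OF rs(1) ctx] whisker_cells2[OF steps_cells2[OF *(2)] assms(2)] by simp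
  moreover have "seq_cell P (src1 P (?w G)) (?w G # map ?w Gs) = ?w ?g"
    using whisker_rseq[OF rs(2) ctx(1,2)] ctx(3,4) *(4)
      whisker_cells2[OF steps_cells2[OF *(3)] ctxG] by simp
  moreover have "cong_ext P \<Gamma> (incl2 P (?w ?f)) (incl2 P (?w ?g))"
    using cong_ext_whisker[OF *(7)] composable_ctx_cong[OF cf, of "incl2 P ?f"]
      incl2_whisker[OF f(1) cf] incl2_whisker[OF g(1) cg] f(1) by simp
  moreover have "sd_diagram P r \<psi> (?w F) (map ?w Fs) (?w G) (map ?w Gs)"
    using compatible *(1) assms(2) unfolding compatible_with_contexts_def by blast
  ultimately show ?thesis unfolding coherent_sd_def by metis
qed

lemma coherent_sd_peiffer:
  assumes "peiffer_decreasing P r \<psi> \<Gamma>" "peiffer_pair P F G"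
  shows "coherent_sd (peiffer_left P F G) (peiffer_right P F G)"
proof -
  let ?L = "peiffer_left P F G" and ?R = "peiffer_right P F G"
  let ?A = "hcomp P False (ident1 P False (tgt1 P F)) G"
    and ?B = "hcomp P False F (ident1 P False (tgt1 P G))"
  obtain Fs Gs where *: "sd_diagram P r \<psi> ?L Fs ?R Gs"
    "cong_ext P \<Gamma> (vcomp P True (incl2 P ?A) (inv2 P (incl2 P ?B)))
      (vcomp P True (incl2 P (seq_cell P (tgt1 P ?L) Fs))
         (inv2 P (incl2 P (seq_cell P (tgt1 P ?R) Gs))))"
    using assms unfolding peiffer_decreasing_def by blast
  let ?X = "seq_cell P (tgt1 P ?L) Fs" and ?Y = "seq_cell P (tgt1 P ?R) Gs"
  have F: "F \<in> cells2 P False" and G: "G \<in> cells2 P False" and FG: "tgt0 (src1 P F) = src0 (src1 P G)"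
    using assms(2) steps_cells2 unfolding peiffer_pair_def by auto
  have L: "?L \<in> cells2 P False" "src1 P ?L = comp1 (src1 P F) (src1 P G)"
      "tgt1 P ?L = comp1 (tgt1 P F) (src1 P G)"
    and R: "?R \<in> cells2 P False" "src1 P ?R = comp1 (src1 P F) (src1 P G)"
      "tgt1 P ?R = comp1 (src1 P F) (tgt1 P G)"
    using F G FG unfolding peiffer_left_def peiffer_right_def by simp_all
  have A: "?A \<in> cells2 P False" "src1 P ?A = comp1 (tgt1 P F) (src1 P G)"
      "tgt1 P ?A = comp1 (tgt1 P F) (tgt1 P G)"
    and B: "?B \<in> cells2 P False" "src1 P ?B = comp1 (src1 P F) (tgt1 P G)"
      "tgt1 P ?B = comp1 (tgt1 P F) (tgt1 P G)"
    using F G FG by simp_all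
  obtain q where "rseq P (tgt1 P ?L) Fs q" "rseq P (tgt1 P ?R) Gs q"
    using *(1) unfolding sd_diagram_def confluence_diagram_def by blast
  then have X: "?X \<in> cells2 P False" "src1 P ?X = tgt1 P ?L" "tgt1 P ?X = q"
    and Y: "?Y \<in> cells2 P False" "src1 P ?Y = tgt1 P ?R" "tgt1 P ?Y = q"
    using seq_cell_cells2 by blast+
  \<comment> \<open>Both sides equal the horizontal composite of \<open>F\<close> and
    \<open>G\<close> by the exchange law.\<close>
  have "vcomp P False ?L ?A = vcomp P False ?R ?B"
    using hcomp_decompose[OF F G FG] unfolding peiffer_left_def peiffer_right_def by metis
  then have sq: "vcomp P True (incl2 P ?L) (incl2 P ?A) = vcomp P True (incl2 P ?R) (incl2 P ?B)"
    using L R A B incl2_vcomp[of ?L ?A] incl2_vcomp[of ?R ?B] by simp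
  define l a r' b x y where defs: "l = class3 (incl2 P ?L)" "a = class3 (incl2 P ?A)"
    "r' = class3 (incl2 P ?R)" "b = class3 (incl2 P ?B)"
    "x = class3 (incl2 P ?X)" "y = class3 (incl2 P ?Y)"
  have hom: "l \<in> hom3 (src1 P ?L) (tgt1 P ?L)" "a \<in> hom3 (tgt1 P ?L) (tgt1 P ?A)"
    "r' \<in> hom3 (src1 P ?L) (tgt1 P ?R)" "b \<in> hom3 (tgt1 P ?R) (tgt1 P ?A)"
    "x \<in> hom3 (tgt1 P ?L) q" "y \<in> hom3 (tgt1 P ?R) q"
    using class3_hom3[of "incl2 P ?L"] class3_hom3[of "incl2 P ?R"] class3_hom3[of "incl2 P ?A"]
      class3_hom3[of "incl2 P ?B"] class3_hom3[of "incl2 P ?X"] class3_hom3[of "incl2 P ?Y"]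
      L R A B X Y unfolding defs by simp_all
  have la: "comp3 l a = comp3 r' b"
    using sq L R A B unfolding defs by simp
  have ab: "comp3 a (inv3 b) = comp3 x (inv3 y)"
    using class3_eqI[OF *(2)] L R A B X Y unfolding defs by simp
  have "comp3 l x = comp3 r' y"
    using Q.peiffer_square[OF hom la ab] .
  then have "class3 (incl2 P (vcomp P False ?L ?X)) = class3 (incl2 P (vcomp P False ?R ?Y))"
    using L R X Y unfolding defs by (simp add: incl2_vcomp)
  then have "cong_ext P \<Gamma> (incl2 P (vcomp P False ?L ?X)) (incl2 P (vcomp P False ?R ?Y))"
    using class3_eqD R Y by simp
  then show ?thesis using *(1) unfolding coherent_sd_def seq_cell.simps by blast
qed

lemma coherent_sd_critical:
  assumes "generating_sd_confluences P r \<psi> (\<Gamma>\<lparr>gens3 := C\<rparr>)" "C \<subseteq> gens3 \<Gamma>"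
    "B \<in> critical_branchings P"
  shows "\<exists>F G. B = {F, G} \<and> coherent_sd F G"
proof -
  obtain D where D: "bij_betw D (critical_branchings P) C"
    "\<forall>B\<in>critical_branchings P. \<exists>F G Fs Gs. B = {F, G} \<and> sd_diagram P r \<psi> F Fs G Gs \<and>
           gsrc2 \<Gamma> (D B) = incl2 P (seq_cell P (src1 P F) (F # Fs)) \<and>
           gtgt2 \<Gamma> (D B) = incl2 P (seq_cell P (src1 P G) (G # Gs))"
    using assms(1) unfolding generating_sd_confluences_def by auto
  then obtain F G Fs Gs where *: "B = {F, G}" "sd_diagram P r \<psi> F Fs G Gs"
    "gsrc2 \<Gamma> (D B) = incl2 P (seq_cell P (src1 P F) (F # Fs))"
    "gtgt2 \<Gamma> (D B) = incl2 P (seq_cell P (src1 P G) (G # Gs))"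
    using assms(3) by meson
  have "D B \<in> gens3 \<Gamma>" using bij_betwE[OF D(1)] assms(2,3) by blast
  from cong_ext.gen[OF this] show ?thesis using * unfolding coherent_sd_def by metis
qed

text \<open>Rotations lead from \<open>F\<close> to the representative of its class, which a 3-cell
  contracts to an identity. Triviality is carried back along the rotations.\<close>

lemma null_elementary:
  assumes "loop_extension P (\<Gamma>\<lparr>gens3 := L\<rparr>)" "L \<subseteq> gens3 \<Gamma>" "F \<in> elementary_loops P"
  shows "null F"
proof -
  obtain R A where *: "\<forall>F\<in>elementary_loops P. \<exists>!\<alpha>. \<alpha> \<in> R \<and> loop_equiv P F \<alpha>"
    "bij_betw A R L"
    "\<forall>\<alpha>\<in>R. gsrc2 \<Gamma> (A \<alpha>) = incl2 P \<alpha> \<and> gtgt2 \<Gamma> (A \<alpha>) = ident1 P True (src1 P \<alpha>)"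
    using assms(1) unfolding loop_extension_def by auto
  obtain \<alpha> where \<alpha>: "\<alpha> \<in> R" "(rotated P)\<^sup>*\<^sup>* F \<alpha>"
    using *(1) assms(3) unfolding loop_equiv_def by blast
  have "A \<alpha> \<in> gens3 \<Gamma>" using bij_betwE[OF *(2)] \<alpha>(1) assms(2) by blast
  then have "null \<alpha>" using class3_eqI[OF cong_ext.gen] *(3) \<alpha>(1) by fastforce
  with \<alpha>(2) show ?thesis
  proof (induction rule: converse_rtranclp_induct)
    case (step F G)
    then show ?case using null_rotated[OF step(1)] by blast
  qed
qed

text \<open>A branching is an unordered pair, so its source is read off an arbitrary member; both
  members of a local branching share it.\<close>

definition blen :: "('v, 'e, 'a) cell2 set \<Rightarrow> nat" where
  "blen B = length (fst (snd (src1 P (SOME F. F \<in> B))))"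

lemma blen_pair:
  assumes "src1 P G = src1 P F"
  shows "blen {F, G} = length (fst (snd (src1 P F)))"
proof -
  have "(SOME H. H \<in> {F, G}) \<in> {F, G}" by (rule someI_ex) blast
  then show ?thesis using assms unfolding blen_def by auto
qed

text \<open>A context with a nonempty side lengthens the common source; one with two empty sides
  consists of identities and changes nothing.\<close>

lemma ctx_branching_cases:
  assumes "ctx_branching P B B'"
  shows "B' \<in> local_branchings P \<and> (B = B' \<or> blen B < blen B')"
proof -
  obtain u v where uv: "B \<in> local_branchings P" "\<forall>F\<in>B. composable_ctx P u F v"
    "B' = (\<lambda>F. whisker P False u F v) ` B"
    using assms unfolding ctx_branching_def by blast
  obtain F G where FG: "B = {F, G}" "F \<in> steps P" "G \<in> steps P" "src1 P F = src1 P G"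
    using uv(1) unfolding local_branchings_def local_branching_def by blast
  have "composable_ctx P u F v" "composable_ctx P u G v"
    "B' = {whisker P False u F v, whisker P False u G v}"
    using uv(2) unfolding uv(3) FG(1) by simp_all
  note * = FG this
  have F: "F \<in> cells2 P False" and G: "G \<in> cells2 P False" using * steps_cells2 by auto
  note wF = whisker_cells2[OF F *(5)] and wG = whisker_cells2[OF G *(6)]
  have "local_branching P (whisker P False u F v) (whisker P False u G v)"
    using whisker_steps[OF *(2,5)] whisker_steps[OF *(3,6)] wF(2) wG(2) *(4)
    unfolding local_branching_def by simp
  then have "B' \<in> local_branchings P" unfolding *(7) local_branchings_def by blast
  moreover have "B = B' \<or> blen B < blen B'"
  proof (cases "fst (snd u) = [] \<and> fst (snd v) = []")
    case True
    then have "u = ident0 (src0 (src1 P F))" "v = ident0 (tgt0 (src1 P F))"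
      using cells1_Nil composable_ctxD[OF *(5)] by metis+
    then have "B = B'" using whisker_ident0[OF F] whisker_ident0[OF G] *(1,4,7) by simp
    then show ?thesis ..
  next
    case False
    then show ?thesis
      using wF wG *(4) unfolding *(1) *(7) by (simp add: blen_pair)
  qed
  ultimately show ?thesis by blast
qed

lemma ctx_branching_rtranclp:
  "(ctx_branching P)\<^sup>*\<^sup>* B B' \<Longrightarrow> B = B' \<or> blen B < blen B'"
  by (induction rule: rtranclp_induct) (auto dest: ctx_branching_cases)

lemma coherent_sd_ctx:
  assumes "(ctx_branching P)\<^sup>*\<^sup>* B B'" "\<exists>F G. B = {F, G} \<and> coherent_sd F G"
  shows "\<exists>F G. B' = {F, G} \<and> coherent_sd F G"
  using assms
proof (induction rule: rtranclp_induct)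
  case (step B' B'')
  then obtain F G where FG: "B' = {F, G}" "coherent_sd F G" by blast
  obtain u v where uv: "\<forall>F\<in>B'. composable_ctx P u F v" "B'' = (\<lambda>F. whisker P False u F v) ` B'"
    using step(2) unfolding ctx_branching_def by blast
  then have "coherent_sd (whisker P False u F v) (whisker P False u G v)"
    using coherent_sd_whisker[OF FG(2)] FG(1) by simp
  moreover have "B'' = {whisker P False u F v, whisker P False u G v}" using uv(2) FG(1) by simp
  ultimately show ?case by blast
qed

text \<open>Below the given branching lies a minimal one, which is aspherical, Peiffer or critical
  and so has a coherent diagram. Contexts carry this diagram back up.\<close>

lemma local_branching_coherent_sd:
  assumes peiffer: "peiffer_decreasing P r \<psi> \<Gamma>"
    and critical: "\<And>B. B \<in> critical_branchings P \<Longrightarrow> \<exists>F G. B = {F, G} \<and> coherent_sd F G"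
    and "local_branching P F G"
  shows "coherent_sd F G"
proof -
  let ?below = "\<lambda>B. B \<in> local_branchings P \<and> (ctx_branching P)\<^sup>*\<^sup>* B {F, G}"
  have "?below {F, G}" using assms(3) unfolding local_branchings_def by blast
  then obtain B where B: "?below B" "\<And>B'. ?below B' \<Longrightarrow> blen B \<le> blen B'"
    using ex_has_least_nat[of ?below "{F, G}" blen] by blast
  \<comment> \<open>A branching strictly below \<open>B\<close> would have a shorter source, against
    the choice of \<open>B\<close>.\<close>
  have min: "B' = B" if "B' \<in> local_branchings P" "(ctx_branching P)\<^sup>*\<^sup>* B' B" for B'
    using that B ctx_branching_rtranclp[OF that(2)] rtranclp_trans[of "ctx_branching P" B' B "{F, G}"]
    by fastforce
  consider "B \<in> aspherical_branchings P" | "B \<in> peiffer_branchings P" | "B \<in> critical_branchings P"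
    using B(1) min unfolding critical_branchings_def overlapping_branchings_def by blast
  then have "\<exists>F' G'. B = {F', G'} \<and> coherent_sd F' G'"
  proof cases
    case 1
    then show ?thesis using coherent_sd_refl unfolding aspherical_branchings_def by blast
  next
    case 2
    then show ?thesis using coherent_sd_peiffer[OF peiffer] unfolding peiffer_branchings_def by blast
  next
    case 3
    then show ?thesis by (rule critical)
  qed
  then have "\<exists>F' G'. {F, G} = {F', G'} \<and> coherent_sd F' G'"
    by (rule coherent_sd_ctx[OF conjunct2[OF B(1)]])
  then show ?thesis using coherent_sd_sym by (metis doubleton_eq_iff)
qed

text \<open>The completing sequences become directed paths, which puts the diagram in the form of
  the local hypothesis of \<open>zig_parallel\<close>.\<close>

lemma coherent_sd_pos:
  assumes "coherent_sd F G"
  shows "\<exists>x y w. S.pos {k. (k, \<psi> F) \<in> r} (tgt1 P F) x w \<and> S.pos {k. (k, \<psi> G) \<in> r} (tgt1 P G) y w \<and>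
    comp3 (class3 (incl2 P F)) x = comp3 (class3 (incl2 P G)) y"
proof -
  obtain Fs Gs q where *: "sd_diagram P r \<psi> F Fs G Gs"
    "F \<in> steps P" "G \<in> steps P" "src1 P G = src1 P F"
    "rseq P (tgt1 P F) Fs q" "rseq P (tgt1 P G) Gs q"
    "cong_ext P \<Gamma> (incl2 P (seq_cell P (src1 P F) (F # Fs)))
       (incl2 P (seq_cell P (src1 P G) (G # Gs)))"
    using assms by (rule coherent_sdE)
  have labels: "\<psi> ` set Fs \<subseteq> {k. (k, \<psi> F) \<in> r}" "\<psi> ` set Gs \<subseteq> {k. (k, \<psi> G) \<in> r}"
    using *(1) unfolding sd_diagram_def by auto
  have "comp3 (class3 (incl2 P F)) (class3 (incl2 P (seq_cell P (tgt1 P F) Fs)))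
      = comp3 (class3 (incl2 P G)) (class3 (incl2 P (seq_cell P (tgt1 P G) Gs)))"
    using class3_eqI[OF *(7)] seq_cell_cells2[OF *(5)] seq_cell_cells2[OF *(6)]
      steps_cells2[OF *(2)] steps_cells2[OF *(3)] by (simp add: incl2_vcomp)
  then show ?thesis using rseq_pos[OF *(5) labels(1)] rseq_pos[OF *(6) labels(2)] by blast
qed

end

theorem theorem3p2p1:
  fixes P :: "('v, 'e, 'a) polygraph2"
    and r :: "('w \<times> 'w) set"
    and \<psi> :: "('v, 'e, 'a) cell2 \<Rightarrow> 'w"
    and \<Gamma> :: "('c, ('v, 'e, 'a) cell2) globular_ext"
  assumes "strictly_decreasing P r \<psi>"
    and "sd_squier_completion P r \<psi> \<Gamma>"
    and "compatible_with_contexts P r \<psi>"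
    and "peiffer_decreasing P r \<psi> \<Gamma>"
  shows "coherent_presentation P \<Gamma>"
proof -
  interpret labelled_polygraph P \<Gamma> r \<psi>
    using assms(1,3,4) unfolding strictly_decreasing_def peiffer_decreasing_def
    by unfold_locales blast+
  obtain C L where CL: "gens3 \<Gamma> = C \<union> L" "generating_sd_confluences P r \<psi> (\<Gamma>\<lparr>gens3 := C\<rparr>)"
    "loop_extension P (\<Gamma>\<lparr>gens3 := L\<rparr>)"
    using assms(2) unfolding sd_squier_completion_def by blast
  have local: "coherent_sd F G" if "local_branching P F G" for F G
    using local_branching_coherent_sd[OF assms(4) coherent_sd_critical[OF CL(2)] that] CL(1) by blast
  have null: "null F" if "F \<in> loops P" for F
    using null_loop[OF null_elementary[OF CL(3)] that] CL(1) by blast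
  \<comment> \<open>Every 2-cell is the value of a zigzag of steps, so parallel 2-cells fall under
    \<open>zig_parallel\<close> with all labels allowed.\<close>
  have filler: "class3 F = class3 G" if "F \<in> cells2 P True" "G \<in> cells2 P True" "parallel2 P F G" for F G
  proof (rule S.zig_parallel)
    show "S.zig UNIV (src1 P F) (class3 F) (tgt1 P F)" "S.zig UNIV (src1 P F) (class3 G) (tgt1 P F)"
      using that zig_cells2[of F] zig_cells2[of G] unfolding parallel2_def by simp_all
  next
    fix u x assume "S.pos UNIV u x u"
    then show "x = class3 (ident1 P True u)"
      using pos_cells2 null unfolding loops_def by fastforce
  next
    fix F' G' assume "F' \<in> steps P" "G' \<in> steps P" "src1 P F' = src1 P G'"
    then show "\<exists>x y w. S.pos {k. (k, \<psi> F') \<in> r} (tgt1 P F') x w \<and>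
        S.pos {k. (k, \<psi> G') \<in> r} (tgt1 P G') y w \<and>
        comp3 (class3 (incl2 P F')) x = comp3 (class3 (incl2 P G')) y"
      using coherent_sd_pos local unfolding local_branching_def by blast
  qed
  \<comment> \<open>Equal classes mean congruent 2-cells, and a congruence is realized by a
    3-cell.\<close>
  show ?thesis
    unfolding coherent_presentation_def
    using polygraph globular cong_ext_cells3[OF class3_eqD[OF _ filler]] by simp
qed

end
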